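(* Fix $n\ge1$. (a) The sets $TPM_n(\epsilon)$, $\epsilon\in\{\pm1\}^n$, are nonempty and pairwise disjoint, and their union $TPM_n$ is open and dense in the real symmetric $n\times n$ matrices. More strongly, given any $A=A^T\in\mathbb{R}^{n\times n}$ there exist a sign pattern $\epsilon$ and a sequence $A_m\in TPM_n(\epsilon)$ such that $A_m\to A$ entrywise. (b) Given $\epsilon\in\{\pm1\}^n$ and a matrix $C_\epsilon\in TPM_n(\epsilon)$, the map $$\Phi^{C_\epsilon}:\mathbf{L}_n\to TPM_n(\epsilon),\qquad L\mapsto L^T\,C_\epsilon\,L$$ is a $C^\infty$ diffeomorphism of $\mathbf{L}_n$ onto $TPM_n(\epsilon)$ whose inverse is algorithmic; hence it preserves the families of Borel and Lebesgue sets. (c) For every $\epsilon\in\{\pm1\}^n$, the reversal map $A\mapsto\overleftarrow{A}=(P_nAP_n)^*$ restricts to a linear (smooth) diffeomorphism $LPM_n(\epsilon)\leftrightarrow TPM_n(\epsilon)$ (in both directions). Moreover, for every $B_\epsilon\in LPM_n(\epsilon)$ it yields a commuting square of invertible smooth diffeomorphisms: $L\mapsto\overleftarrow{L}=(P_nLP_n)^T$ maps $\mathbf{L}_n$ to $\mathbf{L}_n$, $A\mapsto\overleftarrow{A}$ maps $LPM_n(\epsilon)$ to $TPM_n(\epsilon)$, and for all $L\in\mathbf{L}_n$ $$\overleftarrow{\Phi_{B_\epsilon}(L)}=\Phi^{\overleftarrow{B_\epsilon}}(\overleftarrow{L}),\qquad\text{i.e.}\qquad \overleftarrow{L B_\epsilon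 L^T}=\overleftarrow{L}^{\,T}\,\overleftarrow{B_\epsilon}\,\overleftarrow{L},$$ where $\Phi_{B_\epsilon}(L)=LB_\epsilon L^T$.
   Context: For $\epsilon\in\{\pm1\}^n$, $LPM_n(\epsilon)$ (resp. $TPM_n(\epsilon)$) is the set of real symmetric $n\times n$ matrices whose leading (resp. trailing) principal $k\times k$ minor is nonzero of sign $\epsilon_k$ for all $1\le k\le n$; $TPM_n=\bigsqcup_\epsilon TPM_n(\epsilon)$. $\mathbf{L}_n$ is the set of real lower triangular $n\times n$ matrices with positive diagonal entries. $P_n\in\mathbb{R}^{n\times n}$ is the anti-diagonal permutation matrix, with $(u,v)$ entry $1$ if $u+v=n+1$ and $0$ otherwise. The reversal of $A\in\mathbb{C}^{n\times n}$ is $\overleftarrow{A}:=(P_nAP_n)^*$ (conjugate transpose). $\mathbf{L}_n$ and $TPM_n(\epsilon),LPM_n(\epsilon)$ are open in the $\frac{n(n+1)}2$-dimensional real vector spaces of lower triangular, respectively symmetric, matrices; smoothness, Borel and Lebesgue sets refer to these. "Algorithmic" means: the entries of $L=(\Phi^{C_\epsilon})^{-1}(A)$ are obtained from those of $A$ and $C_\epsilon$ by an explicit finite procedure using only field operations and positive square roots of positive numbers. *)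

theory Defs
  imports "HOL-Analysis.Analysis"
begin

section \<open>Index sets\<close>

text \<open>
  An \<open>n \<times> n\<close> matrix is an \<open>('a, 'n) sqmat\<close> with \<open>'n\<close> a finite linearly ordered type, \<open>n = CARD('n) \<ge> 1\<close>.
  The element \<open>i\<close> of \<open>'n\<close> stands for the index \<open>index_pos i\<close> in \<open>{1..n}\<close>: this is the
  unique order isomorphism between \<open>'n\<close> and \<open>{1..n}\<close>.
\<close>

type_synonym ('a, 'n) sqmat = "'a^'n^'n"

definition index_pos :: "'n::{finite,linorder} \<Rightarrow> nat" where
  "index_pos i = card {..i}"

definition leading_indices :: "nat \<Rightarrow> 'n::{finite,linorder} set" where
  "leading_indices k = {i. index_pos i \<le> k}"

definition trailing_indices :: "nat \<Rightarrow> 'n::{finite,linorder} set" where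
  "trailing_indices k = {i. CARD('n) < index_pos i + k}"


section \<open>Principal minors and sign patterns\<close>

text \<open>
  The determinant of the submatrix with rows and columns in \<open>I\<close>.  Submatrices of different sizes
  have different types, so the Leibniz formula defining \<^const>\<open>det\<close> is written over \<open>I\<close>; the lemma
  \<open>det_submatrix\<close> identifies it with the library determinant of the submatrix, for any
  enumeration of \<open>I\<close> by a type of the right size.
\<close>

definition principal_minor :: "'n set \<Rightarrow> ('a::comm_ring_1, 'n::finite) sqmat \<Rightarrow> 'a" where
  "principal_minor I A = (\<Sum>p | p permutes I. of_int (sign p) * (\<Prod>i\<in>I. A $ i $ p i))"

lemma det_submatrix:
  fixes f :: "'k::finite \<Rightarrow> 'n::finite"
  assumes "inj f"
  shows "det (\<chi> a b. A $ f a $ f b) = principal_minor (range f) A"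
proof -
  let ?m = "map_permutation (UNIV :: 'k set) f"
  have bij: "bij_betw f UNIV (range f)"
    using assms by (simp add: bij_betw_def)
  have m_f: "?m p (f a) = f (p a)" for p a
    using map_permutation_apply[of f UNIV a p] assms by simp
  have "bij_betw ?m {p. p permutes UNIV} {q. q permutes range f}"
  proof (intro bij_betw_imageI inj_onI subset_antisym subsetI)
    fix p q assume "?m p = ?m q"
    then have "f (p a) = f (q a)" for a
      by (metis m_f)
    then show "p = q"
      using assms by (auto simp: inj_eq)
  next
    fix q assume "q \<in> ?m ` {p. p permutes UNIV}"
    then show "q \<in> {q. q permutes range f}"
      using bij by (auto intro: map_permutation_permutes)
  next
    fix q assume "q \<in> {q. q permutes range f}"
    then have q: "q permutes range f" by simp
    let ?g = "inv_into UNIV f"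
    have g: "bij_betw ?g (range f) UNIV"
      using bij by (rule bij_betw_inv_into)
    have "?m (map_permutation (range f) ?g q) = q"
      using map_permutation_compose_inv[OF g q, of f] by (simp add: f_inv_into_f)
    moreover have "map_permutation (range f) ?g q permutes UNIV"
      using g q by (rule map_permutation_permutes)
    ultimately show "q \<in> ?m ` {p. p permutes UNIV}"
      by (metis (mono_tags) imageI mem_Collect_eq)
  qed
  then have "principal_minor (range f) A =
      (\<Sum>p | p permutes UNIV. of_int (sign (?m p)) * (\<Prod>i\<in>range f. A $ i $ ?m p i))"
    unfolding principal_minor_def by (rule sum.reindex_bij_betw[symmetric])
  also have "\<dots> = (\<Sum>p | p permutes UNIV. of_int (sign p) * (\<Prod>a\<in>UNIV. A $ f a $ f (p a)))"
    using assms by (intro sum.cong) (auto simp: sign_map_permutation prod.reindex m_f)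
  finally show ?thesis
    by (simp add: det_def)
qed

definition symmetric_matrices :: "((real, 'n::finite) sqmat) set" where
  "symmetric_matrices = {A. transpose A = A}"

definition sign_patterns :: "nat \<Rightarrow> (nat \<Rightarrow> real) set" where
  "sign_patterns n = {1..n} \<rightarrow>\<^sub>E {1, -1}"

definition LPM :: "(nat \<Rightarrow> real) \<Rightarrow> ((real, 'n::{finite,linorder}) sqmat) set" where
  "LPM \<epsilon> = {A \<in> symmetric_matrices. \<forall>k\<in>{1..CARD('n)}.
     principal_minor (leading_indices k) A \<noteq> 0 \<and>
     sgn (principal_minor (leading_indices k) A) = \<epsilon> k}"

definition TPM :: "(nat \<Rightarrow> real) \<Rightarrow> ((real, 'n::{finite,linorder}) sqmat) set" where
  "TPM \<epsilon> = {A \<in> symmetric_matrices. \<forall>k\<in>{1..CARD('n)}.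
     principal_minor (trailing_indices k) A \<noteq> 0 \<and>
     sgn (principal_minor (trailing_indices k) A) = \<epsilon> k}"

definition TPM_all :: "((real, 'n::{finite,linorder}) sqmat) set" where
  "TPM_all = (\<Union>\<epsilon>\<in>sign_patterns CARD('n). TPM \<epsilon>)"


section \<open>Lower triangular matrices and the two congruence maps\<close>

definition lower_triangular_matrices :: "((real, 'n::{finite,linorder}) sqmat) set" where
  "lower_triangular_matrices = {L. \<forall>i j. i < j \<longrightarrow> L $ i $ j = 0}"

definition pos_lower_triangular :: "((real, 'n::{finite,linorder}) sqmat) set" where
  "pos_lower_triangular = {L \<in> lower_triangular_matrices. \<forall>i. 0 < L $ i $ i}"

definition Phi_upper :: "(real, 'n::finite) sqmat \<Rightarrow> (real, 'n) sqmat \<Rightarrow> (real, 'n) sqmat" where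
  "Phi_upper C L = transpose L ** C ** L"

definition Phi_lower :: "(real, 'n::finite) sqmat \<Rightarrow> (real, 'n) sqmat \<Rightarrow> (real, 'n) sqmat" where
  "Phi_lower B L = L ** B ** transpose L"


section \<open>Reversal\<close>

definition antidiagonal :: "('a::{zero,one}, 'n::{finite,linorder}) sqmat" where
  "antidiagonal = (\<chi> u v. if index_pos u + index_pos v = CARD('n) + 1 then 1 else 0)"

definition conjugate_transpose :: "complex^'n^'m \<Rightarrow> complex^'m^'n" where
  "conjugate_transpose A = map_matrix cnj (transpose A)"

definition reversal :: "(complex, 'n::{finite,linorder}) sqmat \<Rightarrow> (complex, 'n) sqmat" where
  "reversal A = conjugate_transpose (antidiagonal ** A ** antidiagonal)"

definition real_reversal :: "(real, 'n::{finite,linorder}) sqmat \<Rightarrow> (real, 'n) sqmat" where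
  "real_reversal A = transpose (antidiagonal ** A ** antidiagonal)"


section \<open>Smooth maps and diffeomorphisms between open subsets of linear subspaces\<close>

text \<open>
  \<open>S\<close> is meant to be relatively open in the subspace \<open>V\<close>.  The derivative of \<open>f\<close> at \<open>x\<close> within \<open>S\<close>
  is then uniquely determined on \<open>V\<close>, and only its values on \<open>V\<close> are used.
\<close>

primrec Ck_on :: "nat \<Rightarrow> 'a::real_normed_vector set \<Rightarrow> 'a set \<Rightarrow>
    ('a \<Rightarrow> 'b::real_normed_vector) \<Rightarrow> bool" where
  "Ck_on 0 V S f \<longleftrightarrow> continuous_on S f"
| "Ck_on (Suc k) V S f \<longleftrightarrow> (\<exists>f'. (\<forall>x\<in>S. (f has_derivative f' x) (at x within S)) \<and>
     (\<forall>v\<in>V. Ck_on k V S (\<lambda>x. f' x v)))"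

definition smooth_on :: "'a::real_normed_vector set \<Rightarrow> 'a set \<Rightarrow>
    ('a \<Rightarrow> 'b::real_normed_vector) \<Rightarrow> bool" where
  "smooth_on V S f \<longleftrightarrow> (\<forall>k. Ck_on k V S f)"

definition diffeomorphism_on :: "'a::real_normed_vector set \<Rightarrow> 'a set \<Rightarrow>
    'b::real_normed_vector set \<Rightarrow> 'b set \<Rightarrow> ('a \<Rightarrow> 'b) \<Rightarrow> bool" where
  "diffeomorphism_on V S W T f \<longleftrightarrow>
     subspace V \<and> openin (top_of_set V) S \<and> subspace W \<and> openin (top_of_set W) T \<and>
     bij_betw f S T \<and> smooth_on V S f \<and> smooth_on W T (inv_into S f)"


section \<open>Borel and Lebesgue sets in the spaces of lower triangular and symmetric matrices\<close>

definition borel_subsets :: "'a::topological_space set \<Rightarrow> 'a set \<Rightarrow> 'a set set" where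
  "borel_subsets V S = {B \<in> sets (restrict_space borel V). B \<subseteq> S}"

text \<open>
  In the ambient space of all \<open>n \<times> n\<close> matrices both subspaces are null sets if \<open>n \<ge> 2\<close>, so Lebesgue
  measurability has to be taken in dimension \<open>n (n + 1) div 2\<close>.  The entries on and below the
  diagonal are linear coordinates on the symmetric as well as on the lower triangular matrices.
\<close>

typedef (overloaded) ('n::"{finite,linorder}") tri_index = "{(i::'n, j). j \<le> i}"
  by auto

instance tri_index :: ("{finite,linorder}") finite
proof
  have "finite (range (Rep_tri_index :: 'a tri_index \<Rightarrow> 'a \<times> 'a))"
    by simp
  then show "finite (UNIV :: 'a tri_index set)"
    by (rule finite_imageD) (simp add: inj_on_def Rep_tri_index_inject)
qed

definition tri_coords :: "(real, 'n::{finite,linorder}) sqmat \<Rightarrow> real^('n tri_index)" where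
  "tri_coords A = (\<chi> t. A $ fst (Rep_tri_index t) $ snd (Rep_tri_index t))"

definition lebesgue_subsets :: "((real, 'n::{finite,linorder}) sqmat) set \<Rightarrow> ((real, 'n) sqmat) set set" where
  "lebesgue_subsets S = {B. B \<subseteq> S \<and> tri_coords ` B \<in> sets lebesgue}"


section \<open>Algebraic procedures with square roots\<close>

text \<open>
  A finite procedure for one real number, written as an expression tree.  Its inputs are the
  entries of two matrices; the only constant is \<open>1\<close>, so that no further real number can
  be built into a procedure.
\<close>

datatype 'n procedure =
    First_Entry 'n 'n
  | Second_Entry 'n 'n
  | One
  | Plus "'n procedure" "'n procedure"
  | Minus "'n procedure" "'n procedure"
  | Times "'n procedure" "'n procedure"
  | Divide "'n procedure" "'n procedure"
  | Sqrt "'n procedure"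

text \<open>
  \<open>computes A C e r\<close>: the procedure \<open>e\<close>, run on the entries of \<open>A\<close> and \<open>C\<close>, never divides by zero
  or takes the square root of a number that is not positive, and returns \<open>r\<close>.
\<close>

inductive computes :: "(real, 'n::finite) sqmat \<Rightarrow> (real, 'n) sqmat \<Rightarrow> 'n procedure \<Rightarrow> real \<Rightarrow> bool"
  for A C :: "(real, 'n::finite) sqmat" where
  "computes A C (First_Entry i j) (A $ i $ j)"
| "computes A C (Second_Entry i j) (C $ i $ j)"
| "computes A C One 1"
| "computes A C e r \<Longrightarrow> computes A C e' r' \<Longrightarrow> computes A C (Plus e e') (r + r')"
| "computes A C e r \<Longrightarrow> computes A C e' r' \<Longrightarrow> computes A C (Minus e e') (r - r')"
| "computes A C e r \<Longrightarrow> computes A C e' r' \<Longrightarrow> computes A C (Times e e') (r * r')"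
| "computes A C e r \<Longrightarrow> computes A C e' r' \<Longrightarrow> r' \<noteq> 0 \<Longrightarrow> computes A C (Divide e e') (r / r')"
| "computes A C e r \<Longrightarrow> 0 < r \<Longrightarrow> computes A C (Sqrt e) (sqrt r)"

end

theory Submission
  imports Defs
begin

text \<open>
  A symmetric matrix with nonzero trailing principal minors has a unique factorisation
  \<open>A = M\<^sup>T D M\<close> with \<open>M\<close> unit lower triangular and \<open>D\<close> diagonal; the trailing minors are the
  products of the last entries of \<open>D\<close>, so the sign pattern of \<open>A\<close> determines the signs of \<open>D\<close>.
  If \<open>A = M\<^sup>T E M\<close> and \<open>C = N\<^sup>T D N\<close> share their sign pattern, then \<open>E / D > 0\<close>, and
  \<open>L\<^sup>T C L = A\<close> holds for the lower triangular \<open>L\<close> with positive diagonal exactly when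
  \<open>N L = sqrt (E / D) M\<close>.  All entries are computed by descending and ascending recursions from
  field operations and positive square roots.  Smoothness of the inverse is read off from the
  procedure itself, by induction on its expression tree.  Images of Lebesgue sets under
  differentiable maps between spaces of equal dimension are Lebesgue sets.
\<close>

section \<open>Finite linear orders\<close>

text \<open>If \<open>L\<close> is lower triangular, the block of
  \<open>transpose L ** C ** L\<close> on \<open>{i..}\<close> involves only the blocks of
  \<open>L\<close> and \<open>C\<close> on \<open>{i..}\<close>; this is why trailing minors belong
  to this congruence. Elimination started at the last index meets exactly these minors: its pivots
  are quotients of consecutive ones. Pivots may be negative, so a real Cholesky factor of
  \<open>A\<close> need not exist. Measuring \<open>A\<close> against a \<open>C\<close> of the same
  pattern puts only positive quotients of pivots under the root. Blocks of different sizes have no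
  common matrix type, so each block is completed by an identity to full size. The factors are given
  by total recursions rather than by existence statements, because the inverse must be one
  expression tree per entry, fixed before the matrices and the pattern are known. Leading minors
  require no second factorisation: reversal is an involution that exchanges them with trailing
  minors and exchanges the two kinds of congruence, so everything about them is obtained by
  conjugation.\<close>

lemma card_lessThan_less: "k < i \<Longrightarrow> card {..<k} < card {..<i}"
  for i k :: "'n::{finite,linorder}"
  by (intro psubset_card_mono) auto

lemma card_greaterThan_less: "i < k \<Longrightarrow> card {k<..} < card {i<..}"
  for i k :: "'n::{finite,linorder}"
  by (intro psubset_card_mono) auto

lemma finite_linorder_induct [case_names less]:
  fixes i :: "'n::{finite,linorder}"
  assumes "\<And>i. (\<And>k. k < i \<Longrightarrow> P k) \<Longrightarrow> P i"
  shows "P i"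
  by (induction i rule: measure_induct_rule[where f = "\<lambda>i. card {..<i}"])
    (rule assms, simp add: card_lessThan_less)

lemma finite_linorder_induct_down [case_names greater]:
  fixes i :: "'n::{finite,linorder}"
  assumes "\<And>i. (\<And>k. i < k \<Longrightarrow> P k) \<Longrightarrow> P i"
  shows "P i"
  by (induction i rule: measure_induct_rule[where f = "\<lambda>i. card {i<..}"])
    (rule assms, simp add: card_greaterThan_less)

lemma index_pos_less_iff: "index_pos i < index_pos j \<longleftrightarrow> i < j"
proof -
  have *: "index_pos i < index_pos j" if "i < j" for i j :: 'a
    unfolding index_pos_def using that by (intro psubset_card_mono) auto
  show ?thesis
    using *[of i j] *[of j i] by (metis less_asym' less_irrefl linorder_neqE)
qed

lemma index_pos_le_iff: "index_pos i \<le> index_pos j \<longleftrightarrow> i \<le> j"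
  using index_pos_less_iff[of j i] by (simp flip: not_less)

lemma index_pos_eq_iff: "index_pos i = index_pos j \<longleftrightarrow> i = j"
  by (simp add: order_eq_iff index_pos_le_iff)

lemma bij_betw_index_pos: "bij_betw index_pos (UNIV :: 'n::{finite,linorder} set) {1..CARD('n)}"
proof -
  have inj: "inj (index_pos :: 'n \<Rightarrow> nat)"
    by (simp add: inj_on_def index_pos_eq_iff)
  have "range (index_pos :: 'n \<Rightarrow> nat) \<subseteq> {1..CARD('n)}"
    by (auto simp: index_pos_def Suc_le_eq card_gt_0_iff card_mono)
  moreover have "card (range (index_pos :: 'n \<Rightarrow> nat)) = card {1..CARD('n)}"
    by (simp add: card_image[OF inj])
  ultimately have "range (index_pos :: 'n \<Rightarrow> nat) = {1..CARD('n)}"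
    by (intro card_subset_eq) auto
  with inj show ?thesis
    by (simp add: bij_betw_def)
qed

lemma index_pos_bounds: "1 \<le> index_pos (i :: 'n::{finite,linorder})" "index_pos i \<le> CARD('n)"
  using bij_betwE[OF bij_betw_index_pos[where 'n = 'n]] by auto

lemma obtain_index:
  assumes "k \<in> {1..CARD('n)}"
  obtains i :: "'n::{finite,linorder}" where "index_pos i = k"
  using assms bij_betw_index_pos[where 'n = 'n] by (metis bij_betw_imp_surj_on imageE)

lemma trailing_indices_atLeast:
  "trailing_indices (CARD('n) + 1 - index_pos i) = {i :: 'n::{finite,linorder}..}"
  using index_pos_bounds[of i]
  by (auto simp: trailing_indices_def index_pos_le_iff[symmetric])

text \<open>\<open>{i..}\<close> has \<open>CARD('n) + 1 - index_pos i\<close> elements.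
  \<open>Q\<close> keeps the size as a second argument because a minor is compared with the sign at
  that position. Indexing by \<open>i\<close> permits descending induction over the order.\<close>

lemma ball_trailing_indices:
  "(\<forall>k\<in>{1..CARD('n)}. Q (trailing_indices k :: 'n::{finite,linorder} set) k) \<longleftrightarrow>
   (\<forall>i :: 'n. Q {i..} (CARD('n) + 1 - index_pos i))"
proof (intro iffI allI ballI)
  fix i :: 'n
  assume *: "\<forall>k\<in>{1..CARD('n)}. Q (trailing_indices k :: 'n set) k"
  have "CARD('n) + 1 - index_pos i \<in> {1..CARD('n)}"
    using index_pos_bounds[of i] by auto
  with * show "Q {i..} (CARD('n) + 1 - index_pos i)"
    by (metis trailing_indices_atLeast)
next
  fix k
  assume *: "\<forall>i :: 'n. Q {i..} (CARD('n) + 1 - index_pos i)" and k: "k \<in> {1..CARD('n)}"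
  then have "CARD('n) + 1 - k \<in> {1..CARD('n)}"
    by auto
  then obtain i :: 'n where i: "index_pos i = CARD('n) + 1 - k"
    by (rule obtain_index)
  then have "k = CARD('n) + 1 - index_pos i"
    using k by auto
  with * show "Q (trailing_indices k) k"
    by (metis trailing_indices_atLeast)
qed


section \<open>Determinants and principal minors\<close>

text \<open>The largest index that is not fixed would move up to an index that is fixed, against
  injectivity.\<close>

lemma permutes_ge_imp_id:
  fixes p :: "'n::{finite,linorder} \<Rightarrow> 'n"
  assumes p: "p permutes S" and ge: "\<And>i. i \<in> S \<Longrightarrow> i \<le> p i"
  shows "p = id"
proof
  fix i
  have "p i = i"
  proof (induction i rule: finite_linorder_induct_down)
    case (greater i)
    have "i \<le> p i"
      using ge p by (cases "i \<in> S") (auto simp: permutes_not_in)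
    moreover have "\<not> i < p i"
      using greater[of "p i"] permutes_inj[OF p] by (metis injD less_irrefl)
    ultimately show ?case by simp
  qed
  then show "p i = id i" by simp
qed

lemma det_lower_triangular:
  fixes L :: "('a::comm_ring_1, 'n::{finite,linorder}) sqmat"
  assumes "\<And>i j. i < j \<Longrightarrow> L $ i $ j = 0"
  shows "det L = (\<Prod>i\<in>UNIV. L $ i $ i)"
proof -
  have "(\<Prod>i\<in>UNIV. L $ i $ p i) = 0" if "p permutes UNIV" "p \<noteq> id" for p
  proof -
    \<comment> \<open>A zero factor requires a row \<open>i\<close> with \<open>i < p i\<close>.
      \<open>permutes_ge_imp_id\<close> yields an index that moves down, hence its application to
      the inverse.\<close>
    have "inv p permutes UNIV" "inv p \<noteq> id"
      using that by (auto simp: permutes_inv) (metis inv_id permutes_inv_inv)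
    then obtain i where "inv p i < i"
      using permutes_ge_imp_id[of "inv p" UNIV] not_le by blast
    then have "L $ inv p i $ p (inv p i) = 0"
      using assms that by (simp add: permutes_inverses)
    then show ?thesis by (intro prod_zero bexI[of _ "inv p i"]) simp_all
  qed
  then have "det L = (\<Sum>p\<in>{id}. of_int (sign p) * (\<Prod>i\<in>UNIV. L $ i $ p i))"
    unfolding det_def by (intro sum.mono_neutral_right) (auto simp: permutes_id)
  then show ?thesis by (simp add: sign_id)
qed

text \<open>The identity outside \<open>I\<close> leaves the determinant of the block unchanged, so
  the rules for determinants of products and transposes become available for minors.\<close>

definition pad :: "'n set \<Rightarrow> ('a::comm_ring_1, 'n::finite) sqmat \<Rightarrow> ('a, 'n) sqmat" where
  "pad I A = (\<chi> i j. if i \<in> I \<and> j \<in> I then A $ i $ j else if i = j then 1 else 0)"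

text \<open>A permutation that moves a point outside \<open>I\<close> selects an off-diagonal zero
  in that row; the remaining ones are the permutations of \<open>I\<close>.\<close>

lemma det_pad: "det (pad I A) = principal_minor I A"
proof -
  have zero: "(\<Prod>i\<in>UNIV. pad I A $ i $ p i) = 0" if "p permutes UNIV" "\<not> p permutes I" for p
  proof -
    have "\<exists>x. x \<notin> I \<and> p x \<noteq> x"
      using that by (auto simp: permutes_def)
    then obtain x where "x \<notin> I" "p x \<noteq> x"
      by blast
    then have "pad I A $ x $ p x = 0"
      by (simp add: pad_def)
    then show ?thesis
      by (intro prod_zero bexI[of _ x]) simp_all
  qed
  have eq: "(\<Prod>i\<in>UNIV. pad I A $ i $ p i) = (\<Prod>i\<in>I. A $ i $ p i)" if "p permutes I" for p
    using that
    by (intro prod.mono_neutral_cong_right)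
      (auto simp: pad_def permutes_not_in permutes_in_image)
  have "p permutes UNIV" if "p permutes I" for p
    using permutes_subset[OF that] by simp
  then have "det (pad I A) =
      (\<Sum>p | p permutes I. of_int (sign p) * (\<Prod>i\<in>UNIV. pad I A $ i $ p i))"
    unfolding det_def
    by (intro sum.mono_neutral_right) (auto simp: zero)
  also have "\<dots> = principal_minor I A"
    unfolding principal_minor_def by (intro sum.cong) (auto simp: eq)
  finally show ?thesis .
qed

text \<open>For row and column in \<open>I\<close>, either alternative annihilates the terms of the
  inner sum with middle index outside \<open>I\<close>, so blocks multiply like full
  matrices.\<close>

lemma pad_mult:
  assumes "(\<forall>a\<in>I. \<forall>k. k \<notin> I \<longrightarrow> X $ a $ k = 0) \<or> (\<forall>b\<in>I. \<forall>k. k \<notin> I \<longrightarrow> Y $ k $ b = 0)"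
  shows "pad I (X ** Y) = pad I X ** pad I Y"
proof -
  have "pad I (X ** Y) $ a $ b = (\<Sum>k\<in>UNIV. pad I X $ a $ k * pad I Y $ k $ b)" for a b
  proof (cases "a \<in> I")
    case False
    then have "(\<Sum>k\<in>UNIV. pad I X $ a $ k * pad I Y $ k $ b) =
        (\<Sum>k\<in>UNIV. if a = k then pad I Y $ k $ b else 0)"
      by (intro sum.cong) (auto simp: pad_def)
    also have "\<dots> = pad I Y $ a $ b"
      by simp
    finally show ?thesis
      using False by (simp add: pad_def)
  next
    case a: True
    show ?thesis
    proof (cases "b \<in> I")
      case False
      then have "(\<Sum>k\<in>UNIV. pad I X $ a $ k * pad I Y $ k $ b) =
          (\<Sum>k\<in>UNIV. if b = k then pad I X $ a $ k else 0)"
        by (intro sum.cong) (auto simp: pad_def)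
      also have "\<dots> = pad I X $ a $ b"
        by simp
      finally show ?thesis
        using False by (simp add: pad_def)
    next
      case b: True
      have "(\<Sum>k\<in>UNIV. pad I X $ a $ k * pad I Y $ k $ b) = (\<Sum>k\<in>UNIV. X $ a $ k * Y $ k $ b)"
        using assms a b by (intro sum.cong) (auto simp: pad_def)
      then show ?thesis
        using a b by (simp add: pad_def matrix_matrix_mult_def)
    qed
  qed
  then show ?thesis
    by (simp add: vec_eq_iff matrix_matrix_mult_def)
qed

lemma principal_minor_cong:
  assumes "\<And>i j. i \<in> I \<Longrightarrow> j \<in> I \<Longrightarrow> A $ i $ j = B $ i $ j"
  shows "principal_minor I A = principal_minor I B"
proof -
  have "pad I A = pad I B"
    using assms by (auto simp: pad_def vec_eq_iff)
  then show ?thesis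
    by (metis det_pad)
qed

lemma principal_minor_lower_triangular:
  fixes L :: "('a::comm_ring_1, 'n::{finite,linorder}) sqmat"
  assumes "\<And>i j. i < j \<Longrightarrow> L $ i $ j = 0"
  shows "principal_minor I L = (\<Prod>i\<in>I. L $ i $ i)"
proof -
  have "principal_minor I L = (\<Prod>i\<in>UNIV. pad I L $ i $ i)"
    unfolding det_pad[symmetric] using assms by (intro det_lower_triangular) (auto simp: pad_def)
  also have "\<dots> = (\<Prod>i\<in>I. L $ i $ i)"
    by (intro prod.mono_neutral_cong_right) (auto simp: pad_def)
  finally show ?thesis .
qed

lemma principal_minor_Phi_upper:
  fixes L :: "(real, 'n::{finite,linorder}) sqmat"
  assumes L: "L \<in> lower_triangular_matrices"
  shows "principal_minor {i..} (Phi_upper C L) = (\<Prod>k\<in>{i..}. L $ k $ k)\<^sup>2 * principal_minor {i..} C"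
proof -
  have *: "L $ a $ b = 0" if "a < b" for a b
    using L that by (simp add: lower_triangular_matrices_def)
  have "pad {i..} (Phi_upper C L) = pad {i..} (transpose L) ** pad {i..} C ** pad {i..} L"
    unfolding Phi_upper_def
    \<comment> \<open>The outer product has \<open>L\<close> as right factor and uses the second
      alternative of \<open>pad_mult\<close>; the inner one has \<open>transpose L\<close> as left
      factor and uses the first.\<close>
    by (subst pad_mult; (subst pad_mult)?) (auto simp: transpose_def intro!: *)
  also have "pad {i..} (transpose L) = transpose (pad {i..} L)"
    by (auto simp: pad_def transpose_def vec_eq_iff)
  finally have "det (pad {i..} (Phi_upper C L)) = (det (pad {i..} L))\<^sup>2 * det (pad {i..} C)"
    by (simp add: det_mul power2_eq_square)
  then show ?thesis
    by (simp add: det_pad principal_minor_lower_triangular[OF *])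
qed

lemma continuous_on_principal_minor [continuous_intros]:
  "continuous_on S f \<Longrightarrow> continuous_on S (\<lambda>x. principal_minor I (f x :: (real, 'n::finite) sqmat))"
  unfolding principal_minor_def by (intro continuous_intros)


section \<open>Lower triangular and trailing minor matrices\<close>

lemma lower_triangularD: "L \<in> lower_triangular_matrices \<Longrightarrow> i < j \<Longrightarrow> L $ i $ j = 0"
  by (simp add: lower_triangular_matrices_def)

lemma pos_lower_triangularD:
  assumes "L \<in> pos_lower_triangular"
  shows "L \<in> lower_triangular_matrices" "0 < L $ i $ i"
  using assms by (auto simp: pos_lower_triangular_def)

lemma symmetric_matricesD: "A \<in> symmetric_matrices \<Longrightarrow> A $ i $ j = A $ j $ i"
  by (auto simp: symmetric_matrices_def transpose_def vec_eq_iff)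

lemma symmetric_matricesI: "(\<And>i j. A $ i $ j = A $ j $ i) \<Longrightarrow> A \<in> symmetric_matrices"
  by (auto simp: symmetric_matrices_def transpose_def vec_eq_iff)

lemma TPM_iff:
  "A \<in> TPM \<epsilon> \<longleftrightarrow> A \<in> symmetric_matrices \<and> (\<forall>i :: 'n::{finite,linorder}.
     principal_minor {i..} A \<noteq> 0 \<and>
     sgn (principal_minor {i..} A) = \<epsilon> (CARD('n) + 1 - index_pos i))"
  unfolding TPM_def mem_Collect_eq
  by (simp only: ball_trailing_indices[where Q = "\<lambda>I k. principal_minor I A \<noteq> 0 \<and>
        sgn (principal_minor I A) = \<epsilon> k"])

lemma Phi_upper_symmetric: "C \<in> symmetric_matrices \<Longrightarrow> Phi_upper C L \<in> symmetric_matrices"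
  by (simp add: symmetric_matrices_def Phi_upper_def matrix_transpose_mul matrix_mul_assoc)

lemma Phi_upper_TPM:
  assumes "C \<in> TPM \<epsilon>" "L \<in> pos_lower_triangular"
  shows "Phi_upper C L \<in> TPM \<epsilon>"
proof -
  have pos: "0 < (\<Prod>k\<in>{i..}. L $ k $ k)\<^sup>2" for i
    using pos_lower_triangularD(2)[OF assms(2)] by (intro zero_less_power prod_pos) auto
  have "principal_minor {i..} (Phi_upper C L) \<noteq> 0 \<longleftrightarrow> principal_minor {i..} C \<noteq> 0"
    "sgn (principal_minor {i..} (Phi_upper C L)) = sgn (principal_minor {i..} C)" for i
    using pos[of i]
    unfolding principal_minor_Phi_upper[OF pos_lower_triangularD(1)[OF assms(2)]] sgn_mult
    by (simp_all only: mult_eq_0_iff sgn_pos mult_1_left) simp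
  with assms(1) show ?thesis
    by (simp add: TPM_iff Phi_upper_symmetric)
qed

definition diagonal :: "('n::finite \<Rightarrow> real) \<Rightarrow> (real, 'n) sqmat" where
  "diagonal d = (\<chi> i j. if i = j then d i else 0)"

lemma Phi_upper_diagonal_entry:
  "Phi_upper (diagonal d) K $ i $ j = (\<Sum>k\<in>UNIV. K $ k $ i * d k * K $ k $ j)"
  by (simp add: Phi_upper_def diagonal_def matrix_matrix_mult_def transpose_def
      if_distrib[where f = "\<lambda>x. _ * x"] cong: if_cong)

text \<open>Rows before \<open>i\<close> vanish in column \<open>i\<close>. The summand split off is
  the one that elimination recovers after subtracting the later rows.\<close>

lemma Phi_upper_diagonal_lower_entry:
  assumes K: "K \<in> lower_triangular_matrices"
  shows "Phi_upper (diagonal d) K $ i $ j =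
    K $ i $ i * d i * K $ i $ j + (\<Sum>k\<in>{i<..}. K $ k $ i * d k * K $ k $ j)"
proof -
  have "Phi_upper (diagonal d) K $ i $ j = (\<Sum>k\<in>insert i {i<..}. K $ k $ i * d k * K $ k $ j)"
    unfolding Phi_upper_diagonal_entry
    by (intro sum.mono_neutral_right) (auto simp: not_less lower_triangularD[OF K])
  then show ?thesis by simp
qed


section \<open>Triangular factorisation\<close>

text \<open>If \<open>A = K\<^sup>T D K\<close> with \<open>K\<close> lower triangular and \<open>D\<close> diagonal, then
  \<open>reduced_entry A i j = K i i * D i * K i j\<close>; the recursion determines this product from \<open>A\<close> alone.\<close>

function reduced_entry :: "(real, 'n::{finite,linorder}) sqmat \<Rightarrow> 'n \<Rightarrow> 'n \<Rightarrow> real" where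
  "reduced_entry A i j = A $ i $ j -
     (\<Sum>k\<in>{i<..}. reduced_entry A k i * reduced_entry A k j / reduced_entry A k k)"
  by pat_completeness auto
termination
  by (relation "Wellfounded.measure (\<lambda>(A, i, j). card {i<..})")
    (auto intro: card_greaterThan_less)

declare reduced_entry.simps [simp del]

text \<open>This is the source of uniqueness: the products on the right can be read off from the
  congruent matrix alone.\<close>

lemma reduced_Phi_upper_diagonal:
  assumes K: "K \<in> lower_triangular_matrices" "\<And>i. K $ i $ i \<noteq> 0" and d: "\<And>i. d i \<noteq> 0"
  shows "reduced_entry (Phi_upper (diagonal d) K) i j = K $ i $ i * d i * K $ i $ j"
proof (induction i arbitrary: j rule: finite_linorder_induct_down)
  case (greater i j)
  let ?A = "Phi_upper (diagonal d) K"
  have "(\<Sum>k\<in>{i<..}. reduced_entry ?A k i * reduced_entry ?A k j / reduced_entry ?A k k) =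
      (\<Sum>k\<in>{i<..}. K $ k $ i * d k * K $ k $ j)"
  proof (intro sum.cong refl)
    fix k assume "k \<in> {i<..}"
    then have "i < k"
      by simp
    \<comment> \<open>Here \<open>x\<close> is \<open>K $ k $ k\<close> and \<open>e\<close> is
      \<open>d k\<close>; dividing by the pivot restores the summand of the matrix product.\<close>
    have "x * e * y * (x * e * z) / (x * e * x) = y * e * z" if "x \<noteq> 0" "e \<noteq> 0" for x e y z :: real
      using that by simp
    from this[OF K(2) d] show "reduced_entry ?A k i * reduced_entry ?A k j / reduced_entry ?A k k =
        K $ k $ i * d k * K $ k $ j"
      unfolding greater[OF \<open>i < k\<close>] .
  qed
  then show ?case
    by (simp add: reduced_entry.simps[of ?A i j] Phi_upper_diagonal_lower_entry[OF K(1)])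
qed

text \<open>The zeros and ones are imposed by cases instead of coming from the quotient, so the
  matrix is unit lower triangular for every \<open>A\<close>, even where a pivot vanishes.\<close>

definition unit_lower_factor :: "(real, 'n::{finite,linorder}) sqmat \<Rightarrow> (real, 'n) sqmat" where
  "unit_lower_factor A =
     (\<chi> i j. if j < i then reduced_entry A i j / reduced_entry A i i else if i = j then 1 else 0)"

lemma unit_lower_factor_lower: "unit_lower_factor A \<in> lower_triangular_matrices"
  by (auto simp: unit_lower_factor_def lower_triangular_matrices_def)

lemma unit_lower_factor_diag [simp]: "unit_lower_factor A $ i $ i = 1"
  by (simp add: unit_lower_factor_def)

text \<open>Dividing by the pivot at \<open>i\<close> affects only columns before \<open>i\<close>,
  outside the block considered. The pivot at \<open>i\<close> may therefore vanish, and the lemma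
  can serve to prove that it does not.\<close>

lemma unit_lower_factor_entry:
  assumes A: "A \<in> symmetric_matrices"
    and nz: "\<And>k. i < k \<Longrightarrow> reduced_entry A k k \<noteq> 0" and ij: "i \<le> a" "i \<le> b"
  shows "Phi_upper (diagonal (\<lambda>k. reduced_entry A k k)) (unit_lower_factor A) $ a $ b = A $ a $ b"
proof -
  let ?d = "\<lambda>k. reduced_entry A k k" and ?M = "unit_lower_factor A"
  \<comment> \<open>The entries on and below the diagonal are exactly those that the recursion
    reproduces; symmetry of both sides supplies the others.\<close>
  have *: "Phi_upper (diagonal ?d) ?M $ a $ b = A $ a $ b" if "i \<le> b" "b \<le> a" for a b
  proof -
    have "?M $ k $ a * ?d k * ?M $ k $ b =
        reduced_entry A k a * reduced_entry A k b / ?d k" if "a < k" for k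
    proof -
      have "b < k"
        using \<open>b \<le> a\<close> that by (rule le_less_trans)
      moreover have "reduced_entry A k k \<noteq> 0"
        by (rule nz, rule le_less_trans[OF \<open>i \<le> b\<close> \<open>b < k\<close>])
      ultimately show ?thesis
        using that by (simp add: unit_lower_factor_def)
    qed
    moreover have "?M $ a $ a * ?d a * ?M $ a $ b = reduced_entry A a b"
    proof (cases "b = a")
      case False
      with \<open>b \<le> a\<close> have "b < a"
        by simp
      moreover have "reduced_entry A a a \<noteq> 0"
        by (rule nz, rule le_less_trans[OF \<open>i \<le> b\<close> \<open>b < a\<close>])
      ultimately show ?thesis
        by (simp add: unit_lower_factor_def)
    qed simp
    ultimately show ?thesis
      unfolding Phi_upper_diagonal_lower_entry[OF unit_lower_factor_lower]
      by (simp add: reduced_entry.simps[of A a b])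
  qed
  have "diagonal ?d \<in> symmetric_matrices"
    by (auto intro: symmetric_matricesI simp: diagonal_def)
  then have sym: "Phi_upper (diagonal ?d) ?M \<in> symmetric_matrices"
    by (rule Phi_upper_symmetric)
  show ?thesis
    using *[of a b] *[of b a] ij symmetric_matricesD[OF sym, of a b] symmetric_matricesD[OF A, of a b]
    by (metis linear)
qed

lemma principal_minor_diagonal: "principal_minor I (diagonal d) = (\<Prod>i\<in>I. d i)"
  for d :: "'n::{finite,linorder} \<Rightarrow> real"
  by (subst principal_minor_lower_triangular) (auto simp: diagonal_def)

lemma principal_minor_eq_prod_reduced:
  assumes A: "A \<in> symmetric_matrices" and nz: "\<And>k. i < k \<Longrightarrow> reduced_entry A k k \<noteq> 0"
  shows "principal_minor {i..} A = (\<Prod>k\<in>{i..}. reduced_entry A k k)"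
proof -
  have "principal_minor {i..} A =
      principal_minor {i..} (Phi_upper (diagonal (\<lambda>k. reduced_entry A k k)) (unit_lower_factor A))"
    using unit_lower_factor_entry[OF A nz] by (intro principal_minor_cong) auto
  then show ?thesis
    by (simp add: principal_minor_Phi_upper[OF unit_lower_factor_lower] principal_minor_diagonal)
qed

text \<open>Once the later pivots are nonzero, the minor on \<open>{i..}\<close> is the product of
  all pivots from \<open>i\<close> on, so it cannot be nonzero unless the pivot at \<open>i\<close>
  is.\<close>

lemma reduced_diag_nonzero:
  assumes A: "A \<in> TPM \<epsilon>"
  shows "reduced_entry A i i \<noteq> 0"
proof (induction i rule: finite_linorder_induct_down)
  case (greater i)
  then have "principal_minor {i..} A = (\<Prod>k\<in>{i..}. reduced_entry A k k)"
    using A by (intro principal_minor_eq_prod_reduced) (auto simp: TPM_def)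
  moreover have "principal_minor {i..} A \<noteq> 0"
    using A by (simp add: TPM_iff)
  ultimately have "\<forall>k\<in>{i..}. reduced_entry A k k \<noteq> 0"
    by (simp add: prod_zero_iff)
  then show ?case by simp
qed

lemma triangular_factorisation:
  assumes "A \<in> TPM \<epsilon>"
  shows "A = Phi_upper (diagonal (\<lambda>k. reduced_entry A k k)) (unit_lower_factor A)"
proof -
  have "A \<in> symmetric_matrices"
    using assms by (simp add: TPM_def)
  \<comment> \<open>For the entry at \<open>a\<close>, \<open>b\<close> the block starting at
    \<open>min a b\<close> is used.\<close>
  from unit_lower_factor_entry[OF this reduced_diag_nonzero[OF assms]] show ?thesis
    by (metis (no_types, lifting) vec_eq_iff min.cobounded1 min.cobounded2)
qed

text \<open>Two minors of equal sign have a positive quotient, which is the product of the pivot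
  quotients from \<open>i\<close> on. By induction those after \<open>i\<close> are positive, so the
  one at \<open>i\<close> is too.\<close>

lemma reduced_ratio_pos:
  assumes A: "A \<in> TPM \<epsilon>" and C: "C \<in> TPM \<epsilon>"
  shows "0 < reduced_entry A i i / reduced_entry C i i"
proof (induction i rule: finite_linorder_induct_down)
  case (greater i)
  let ?r = "\<lambda>k. reduced_entry A k k / reduced_entry C k k"
  have minor: "principal_minor {i..} X = (\<Prod>k\<in>{i..}. reduced_entry X k k)" if "X \<in> TPM \<epsilon>" for X
    using that reduced_diag_nonzero[OF that]
    by (intro principal_minor_eq_prod_reduced) (auto simp: TPM_def)
  have "principal_minor {i..} A \<noteq> 0"
    "sgn (principal_minor {i..} A) = sgn (principal_minor {i..} C)"
    using A C by (simp_all add: TPM_iff)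
  then have "0 < principal_minor {i..} A / principal_minor {i..} C"
    by (auto simp: sgn_if zero_less_divide_iff split: if_splits)
  also have "\<dots> = (\<Prod>k\<in>{i..}. ?r k)"
    by (simp add: minor A C prod_dividef)
  also have "{i..} = insert i {i<..}"
    by auto
  finally have "0 < ?r i * (\<Prod>k\<in>{i<..}. ?r k)"
    by simp
  moreover have "0 < (\<Prod>k\<in>{i<..}. ?r k)"
    by (intro prod_pos) (auto intro: greater)
  ultimately show ?case
    by (rule zero_less_mult_pos2)
qed

section \<open>Forward substitution and the inverse of the congruence map\<close>

function forward_solve ::
  "(real, 'n::{finite,linorder}) sqmat \<Rightarrow> (real, 'n) sqmat \<Rightarrow> 'n \<Rightarrow> 'n \<Rightarrow> real" where
  "forward_solve N K i j = K $ i $ j - (\<Sum>k\<in>{..<i}. N $ i $ k * forward_solve N K k j)"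
  by pat_completeness auto
termination
  by (relation "Wellfounded.measure (\<lambda>(N, K, i, j). card {..<i})")
    (auto intro: card_lessThan_less)

declare forward_solve.simps [simp del]

lemma matrix_mult_entry: "(A ** B) $ i $ j = (\<Sum>k\<in>UNIV. A $ i $ k * B $ k $ j)"
  by (simp add: matrix_matrix_mult_def)

lemma unit_lower_mult_entry:
  assumes N: "N \<in> lower_triangular_matrices" "\<And>i. N $ i $ i = 1"
  shows "(N ** L) $ i $ j = L $ i $ j + (\<Sum>k\<in>{..<i}. N $ i $ k * L $ k $ j)"
proof -
  have "(N ** L) $ i $ j = (\<Sum>k\<in>insert i {..<i}. N $ i $ k * L $ k $ j)"
    unfolding matrix_mult_entry
    by (intro sum.mono_neutral_right) (auto simp: not_less lower_triangularD[OF N(1)])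
  then show ?thesis by (simp add: N)
qed

text \<open>As an equivalence this gives both existence and uniqueness of solutions: one direction
  makes the congruence map onto, the other lets \<open>N\<close> be cancelled in the proof of
  injectivity.\<close>

lemma forward_solve_iff:
  assumes N: "N \<in> lower_triangular_matrices" "\<And>i. N $ i $ i = 1"
  shows "N ** L = K \<longleftrightarrow> L = (\<chi> i j. forward_solve N K i j)"
proof
  assume eq: "N ** L = K"
  have "L $ i $ j = forward_solve N K i j" for i j
  proof (induction i rule: finite_linorder_induct)
    case (less i)
    have "K $ i $ j = L $ i $ j + (\<Sum>k\<in>{..<i}. N $ i $ k * L $ k $ j)"
      using eq unit_lower_mult_entry[OF N] by metis
    then show ?case
      by (simp add: forward_solve.simps[of N K i j] less)
  qed
  then show "L = (\<chi> i j. forward_solve N K i j)"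
    by (simp add: vec_eq_iff)
next
  assume "L = (\<chi> i j. forward_solve N K i j)"
  then have "(N ** L) $ i $ j = K $ i $ j" for i j
    using forward_solve.simps[of N K i j] by (simp add: unit_lower_mult_entry[OF N])
  then show "N ** L = K"
    by (simp add: vec_eq_iff)
qed

text \<open>The recursion refers only to earlier rows, which already vanish at columns from
  \<open>i\<close> on. Hence zeros above the diagonal propagate, and on the diagonal only the entry
  of \<open>K\<close> survives.\<close>

lemma forward_solve_lower:
  assumes N: "N \<in> lower_triangular_matrices" and K: "K \<in> pos_lower_triangular"
  shows "(\<chi> i j. forward_solve N K i j) \<in> pos_lower_triangular"
proof -
  have 0: "forward_solve N K i j = 0" if "i < j" for i j
    using that
  proof (induction i rule: finite_linorder_induct)
    case (less i)
    have "N $ i $ k * forward_solve N K k j = 0" if "k \<in> {..<i}" for k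
      using less that by (metis less_trans lessThan_iff mult_zero_right)
    moreover have "K $ i $ j = 0"
      using lower_triangularD[OF pos_lower_triangularD(1)[OF K] less.prems] .
    ultimately show ?case
      by (subst forward_solve.simps) (simp add: sum.neutral)
  qed
  have "forward_solve N K i i = K $ i $ i" for i
    by (subst forward_solve.simps) (simp add: 0)
  with 0 show ?thesis
    using pos_lower_triangularD(2)[OF K]
    by (auto simp: pos_lower_triangular_def lower_triangular_matrices_def)
qed

lemma pos_lower_triangular_mult:
  assumes N: "N \<in> pos_lower_triangular" and L: "L \<in> pos_lower_triangular"
  shows "N ** L \<in> pos_lower_triangular"
proof -
  note N' = pos_lower_triangularD[OF N] and L' = pos_lower_triangularD[OF L]
  have "(N ** L) $ i $ j = 0" if "i < j" for i j
    unfolding matrix_mult_entry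
  proof (intro sum.neutral ballI)
    fix k
    have "i < k \<or> k < j"
      using that by (metis le_less_trans not_le)
    then show "N $ i $ k * L $ k $ j = 0"
      using lower_triangularD[OF N'(1), of i k] lower_triangularD[OF L'(1), of k j] by auto
  qed
  moreover have "(N ** L) $ i $ i = N $ i $ i * L $ i $ i" for i
  proof -
    have "(N ** L) $ i $ i = (\<Sum>k\<in>{i}. N $ i $ k * L $ k $ i)"
      unfolding matrix_mult_entry
      using lower_triangularD[OF N'(1), of i] lower_triangularD[OF L'(1), of _ i]
      by (intro sum.mono_neutral_right) (auto, metis linorder_neqE)
    then show ?thesis by simp
  qed
  ultimately show ?thesis
    using N'(2) L'(2) by (simp add: pos_lower_triangular_def lower_triangular_matrices_def)
qed

definition Phi_inverse ::
  "(real, 'n::{finite,linorder}) sqmat \<Rightarrow> (real, 'n) sqmat \<Rightarrow> (real, 'n) sqmat" where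
  "Phi_inverse C A = (\<chi> i j. forward_solve (unit_lower_factor C)
     (\<chi> i j. sqrt (reduced_entry A i i / reduced_entry C i i) * unit_lower_factor A $ i $ j) i j)"

lemma unit_lower_factor_pos_lower: "unit_lower_factor A \<in> pos_lower_triangular"
  using unit_lower_factor_lower by (auto simp: pos_lower_triangular_def)

lemma Phi_upper_mult: "Phi_upper (Phi_upper D N) L = Phi_upper D (N ** L)"
  by (simp add: Phi_upper_def matrix_transpose_mul matrix_mul_assoc)

lemma scaled_unit_lower_factor_pos_lower:
  assumes "A \<in> TPM \<epsilon>" "C \<in> TPM \<epsilon>"
  shows "(\<chi> i j. sqrt (reduced_entry A i i / reduced_entry C i i) * unit_lower_factor A $ i $ j) \<in> pos_lower_triangular"
proof -
  have "0 < sqrt (reduced_entry A i i / reduced_entry C i i)" for i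
    by (simp only: real_sqrt_gt_0_iff reduced_ratio_pos[OF assms])
  then show ?thesis
    using lower_triangularD[OF unit_lower_factor_lower[of A]]
    by (simp add: pos_lower_triangular_def lower_triangular_matrices_def del: real_sqrt_divide)
qed

lemma Phi_inverse_pos_lower:
  assumes "A \<in> TPM \<epsilon>" "C \<in> TPM \<epsilon>"
  shows "Phi_inverse C A \<in> pos_lower_triangular"
  unfolding Phi_inverse_def
  by (intro forward_solve_lower unit_lower_factor_lower scaled_unit_lower_factor_pos_lower[OF assms])

lemma Phi_upper_Phi_inverse:
  assumes A: "A \<in> TPM \<epsilon>" and C: "C \<in> TPM \<epsilon>"
  shows "Phi_upper C (Phi_inverse C A) = A"
proof -
  let ?K = "\<chi> i j. sqrt (reduced_entry A i i / reduced_entry C i i) * unit_lower_factor A $ i $ j"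
  let ?dA = "diagonal (\<lambda>k. reduced_entry A k k)" and ?dC = "diagonal (\<lambda>k. reduced_entry C k k)"
  have "unit_lower_factor C ** Phi_inverse C A = ?K"
    by (subst forward_solve_iff) (auto simp: unit_lower_factor_lower Phi_inverse_def)
  then have "Phi_upper C (Phi_inverse C A) = Phi_upper ?dC ?K"
    using triangular_factorisation[OF C] by (metis Phi_upper_mult)
  also have "\<dots> = Phi_upper ?dA (unit_lower_factor A)"
  proof -
    \<comment> \<open>The scaling enters each summand twice, so its square turns the pivot
      \<open>c\<close> of \<open>C\<close> into the pivot \<open>a\<close> of
      \<open>A\<close>.\<close>
    have scale: "sqrt (a / c) * x * c * (sqrt (a / c) * y) = x * a * y"
      if "0 < a / c" "c \<noteq> 0" for a c x y :: real
    proof -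
      have "sqrt (a / c) * x * c * (sqrt (a / c) * y) = (sqrt (a / c))\<^sup>2 * c * (x * y)"
        by (simp only: power2_eq_square mult_ac)
      also have "(sqrt (a / c))\<^sup>2 = a / c"
        using that by (intro real_sqrt_pow2) simp
      finally show ?thesis
        using that by simp
    qed
    show ?thesis
      unfolding vec_eq_iff Phi_upper_diagonal_entry vec_lambda_beta
      by (intro allI sum.cong refl scale reduced_ratio_pos[OF A C] reduced_diag_nonzero[OF C])
  qed
  also have "\<dots> = A"
    using triangular_factorisation[OF A] by simp
  finally show ?thesis .
qed

text \<open>With \<open>N\<close> the unit factor of \<open>C\<close>, both \<open>N ** L\<close>
  and \<open>N ** L'\<close> have the same reduced entries. Those on the diagonal determine the
  squares of the diagonal, positivity fixes the roots, and division gives the remaining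
  entries.\<close>

lemma inj_on_Phi_upper:
  assumes C: "C \<in> TPM \<epsilon>"
  shows "inj_on (Phi_upper C) pos_lower_triangular"
proof (rule inj_onI)
  fix L L'
  assume L: "L \<in> pos_lower_triangular" and L': "L' \<in> pos_lower_triangular"
    and eq: "Phi_upper C L = Phi_upper C L'"
  let ?d = "\<lambda>k. reduced_entry C k k" and ?N = "unit_lower_factor C"
  have K: "?N ** L \<in> pos_lower_triangular" "?N ** L' \<in> pos_lower_triangular"
    using L L' by (auto intro: pos_lower_triangular_mult unit_lower_factor_pos_lower)
  have eq': "Phi_upper (diagonal ?d) (?N ** L) = Phi_upper (diagonal ?d) (?N ** L')"
    using eq triangular_factorisation[OF C] by (metis Phi_upper_mult)
  have red: "K $ i $ i * ?d i * K $ i $ j = reduced_entry (Phi_upper (diagonal ?d) K) i j"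
    if "K \<in> pos_lower_triangular" for K i j
  proof (rule reduced_Phi_upper_diagonal[symmetric])
    show "K $ i $ i \<noteq> 0" for i
      using pos_lower_triangularD(2)[OF that, of i] by simp
  qed (use pos_lower_triangularD(1)[OF that] reduced_diag_nonzero[OF C] in auto)
  have *: "(?N ** L) $ i $ i * ?d i * (?N ** L) $ i $ j =
      (?N ** L') $ i $ i * ?d i * (?N ** L') $ i $ j" for i j
    unfolding red[OF K(1)] red[OF K(2)] eq' ..
  have diag: "(?N ** L) $ i $ i = (?N ** L') $ i $ i" for i
  proof (rule power2_eq_imp_eq)
    show "((?N ** L) $ i $ i)\<^sup>2 = ((?N ** L') $ i $ i)\<^sup>2"
      using *[of i i] reduced_diag_nonzero[OF C, of i] by (simp add: power2_eq_square)
  qed (use K[THEN pos_lower_triangularD(2), of i] in simp_all)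
  have "(?N ** L) $ i $ j = (?N ** L') $ i $ j" for i j
    using *[of i j] reduced_diag_nonzero[OF C, of i] pos_lower_triangularD(2)[OF K(2), of i]
    by (simp add: diag)
  then have "?N ** L = ?N ** L'"
    by (simp add: vec_eq_iff)
  then show "L = L'"
    by (metis forward_solve_iff unit_lower_factor_lower unit_lower_factor_diag)
qed


section \<open>Smooth maps\<close>

lemma Ck_onI_derivative:
  assumes "\<And>x. x \<in> S \<Longrightarrow> (f has_derivative f' x) (at x within S)"
    and "\<And>v. v \<in> V \<Longrightarrow> Ck_on k V S (\<lambda>x. f' x v)"
  shows "Ck_on (Suc k) V S f"
  using assms by auto

lemma Ck_on_SucE:
  assumes "Ck_on (Suc k) V S f"
  obtains f' where "\<And>x. x \<in> S \<Longrightarrow> (f has_derivative f' x) (at x within S)"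
    "\<And>v. v \<in> V \<Longrightarrow> Ck_on k V S (\<lambda>x. f' x v)"
  using assms by auto

text \<open>The same \<open>f'\<close> serves as derivative of \<open>g\<close>, so the higher
  orders carry over verbatim and a case distinction on \<open>k\<close> replaces an
  induction.\<close>

lemma Ck_on_cong:
  assumes "Ck_on k V S f" "\<And>x. x \<in> S \<Longrightarrow> f x = g x"
  shows "Ck_on k V S g"
proof (cases k)
  case 0
  with assms show ?thesis
    by (simp cong: continuous_on_cong)
next
  case (Suc m)
  with assms(1) obtain f' where f': "\<And>x. x \<in> S \<Longrightarrow> (f has_derivative f' x) (at x within S)"
    "\<And>v. v \<in> V \<Longrightarrow> Ck_on m V S (\<lambda>x. f' x v)"
    by (metis Ck_on_SucE)
  have "(g has_derivative f' x) (at x within S)" if "x \<in> S" for x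
    using that assms(2) by (intro has_derivative_transform[OF _ _ f'(1)]) auto
  then show ?thesis
    unfolding Suc using f'(2) by (rule Ck_onI_derivative)
qed

text \<open>The rules for products and inverses need this: the derivative of a product contains the
  undifferentiated factors, which must then be available at the lower order.\<close>

lemma Ck_on_SucD: "Ck_on (Suc k) V S f \<Longrightarrow> Ck_on k V S f"
proof (induction k arbitrary: f)
  case 0
  then obtain f' where "\<And>x. x \<in> S \<Longrightarrow> (f has_derivative f' x) (at x within S)"
    by (metis Ck_on_SucE)
  then show ?case
    by (auto simp: continuous_on_eq_continuous_within intro: has_derivative_continuous)
next
  case (Suc k)
  from Suc.prems obtain f' where f': "\<And>x. x \<in> S \<Longrightarrow> (f has_derivative f' x) (at x within S)"
    "\<And>v. v \<in> V \<Longrightarrow> Ck_on (Suc k) V S (\<lambda>x. f' x v)"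
    by (metis Ck_on_SucE)
  show ?case
    using f'(1) Suc.IH[OF f'(2)] by (rule Ck_onI_derivative)
qed

lemma Ck_on_const: "Ck_on k V S (\<lambda>x. c)"
  by (induction k arbitrary: c) (auto intro!: exI[of _ "\<lambda>x v. 0"])

lemma Ck_on_bounded_linear:
  assumes "bounded_linear h"
  shows "Ck_on k V S h"
proof (cases k)
  case 0
  with assms show ?thesis
    by (simp add: linear_continuous_on)
next
  case (Suc m)
  show ?thesis
    unfolding Suc
    using bounded_linear_imp_has_derivative[OF assms] by (rule Ck_onI_derivative) (rule Ck_on_const)
qed

lemma Ck_on_compose_linear:
  assumes h: "bounded_linear h" and f: "Ck_on k V S f"
  shows "Ck_on k V S (\<lambda>x. h (f x))"
  using f
proof (induction k arbitrary: f)
  case 0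
  then show ?case
    by (simp add: bounded_linear.continuous_on[OF h])
next
  case (Suc k)
  from Suc.prems obtain f' where f': "\<And>x. x \<in> S \<Longrightarrow> (f has_derivative f' x) (at x within S)"
    "\<And>v. v \<in> V \<Longrightarrow> Ck_on k V S (\<lambda>x. f' x v)"
    by (metis Ck_on_SucE)
  show ?case
    using bounded_linear.has_derivative[OF h f'(1)] Suc.IH[OF f'(2)] by (rule Ck_onI_derivative)
qed

text \<open>A direction \<open>v\<close> becomes the fixed direction \<open>g v\<close> for
  \<open>f\<close>, which is why \<open>g\<close> must also respect the spaces of
  directions.\<close>

lemma Ck_on_linear_compose:
  assumes g: "bounded_linear g" "g ` S' \<subseteq> S" "g ` V' \<subseteq> V" and f: "Ck_on k V S f"
  shows "Ck_on k V' S' (\<lambda>x. f (g x))"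
  using f
proof (induction k arbitrary: f)
  case 0
  have "continuous_on S' g"
    by (rule linear_continuous_on[OF g(1)])
  with 0 g(2) show ?case
    by (auto intro: continuous_on_compose2)
next
  case (Suc k)
  from Suc.prems obtain f' where f': "\<And>x. x \<in> S \<Longrightarrow> (f has_derivative f' x) (at x within S)"
    "\<And>v. v \<in> V \<Longrightarrow> Ck_on k V S (\<lambda>x. f' x v)"
    by (metis Ck_on_SucE)
  show ?case
  proof (rule Ck_onI_derivative)
    fix x assume x: "x \<in> S'"
    show "((\<lambda>x. f (g x)) has_derivative (\<lambda>v. f' (g x) (g v))) (at x within S')"
      by (rule has_derivative_in_compose2[OF f'(1) g(2) x bounded_linear_imp_has_derivative[OF g(1)]])
  next
    fix v assume "v \<in> V'"
    with g(3) show "Ck_on k V' S' (\<lambda>x. f' (g x) (g v))"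
      by (intro Suc.IH f'(2)) auto
  qed
qed

lemma Ck_on_add:
  assumes "Ck_on k V S f" "Ck_on k V S g"
  shows "Ck_on k V S (\<lambda>x. f x + g x)"
  using assms
proof (induction k arbitrary: f g)
  case 0
  then show ?case
    by (simp add: continuous_on_add)
next
  case (Suc k)
  from Suc.prems(1) obtain f' where f': "\<And>x. x \<in> S \<Longrightarrow> (f has_derivative f' x) (at x within S)"
    "\<And>v. v \<in> V \<Longrightarrow> Ck_on k V S (\<lambda>x. f' x v)"
    by (metis Ck_on_SucE)
  from Suc.prems(2) obtain g' where g': "\<And>x. x \<in> S \<Longrightarrow> (g has_derivative g' x) (at x within S)"
    "\<And>v. v \<in> V \<Longrightarrow> Ck_on k V S (\<lambda>x. g' x v)"
    by (metis Ck_on_SucE)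
  show ?case
    by (rule Ck_onI_derivative[OF has_derivative_add[OF f'(1) g'(1)] Suc.IH[OF f'(2) g'(2)]])
qed

lemma Ck_on_uminus: "Ck_on k V S f \<Longrightarrow> Ck_on k V S (\<lambda>x. - f x)"
  by (rule Ck_on_compose_linear[OF bounded_linear_minus[OF bounded_linear_ident]])

lemma Ck_on_diff: "Ck_on k V S f \<Longrightarrow> Ck_on k V S g \<Longrightarrow> Ck_on k V S (\<lambda>x. f x - g x)"
  using Ck_on_add[OF _ Ck_on_uminus, of k V S f g] by simp

lemma Ck_on_sum: "(\<And>i. i \<in> I \<Longrightarrow> Ck_on k V S (f i)) \<Longrightarrow> Ck_on k V S (\<lambda>x. \<Sum>i\<in>I. f i x)"
  by (induction I rule: infinite_finite_induct) (auto intro: Ck_on_const Ck_on_add)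

lemma Ck_on_mult:
  fixes f g :: "'a::real_normed_vector \<Rightarrow> real"
  assumes "Ck_on k V S f" "Ck_on k V S g"
  shows "Ck_on k V S (\<lambda>x. f x * g x)"
  using assms
proof (induction k arbitrary: f g)
  case 0
  then show ?case
    by (simp add: continuous_on_mult)
next
  case (Suc k)
  from Suc.prems(1) obtain f' where f': "\<And>x. x \<in> S \<Longrightarrow> (f has_derivative f' x) (at x within S)"
    "\<And>v. v \<in> V \<Longrightarrow> Ck_on k V S (\<lambda>x. f' x v)"
    by (metis Ck_on_SucE)
  from Suc.prems(2) obtain g' where g': "\<And>x. x \<in> S \<Longrightarrow> (g has_derivative g' x) (at x within S)"
    "\<And>v. v \<in> V \<Longrightarrow> Ck_on k V S (\<lambda>x. g' x v)"
    by (metis Ck_on_SucE)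
  show ?case
    by (rule Ck_onI_derivative[OF has_derivative_mult[OF f'(1) g'(1)]])
      (auto intro!: Ck_on_add Suc.IH f'(2) g'(2) Ck_on_SucD[OF Suc.prems(1)] Ck_on_SucD[OF Suc.prems(2)])
qed

text \<open>The derivative is built from \<open>f'\<close> and from the inverse itself, so the
  induction hypothesis for the same \<open>f\<close> at lower order closes the argument.\<close>

lemma Ck_on_inverse:
  fixes f :: "'a::real_normed_vector \<Rightarrow> real"
  assumes f: "Ck_on k V S f" and nz: "\<And>x. x \<in> S \<Longrightarrow> f x \<noteq> 0"
  shows "Ck_on k V S (\<lambda>x. inverse (f x))"
  using f
proof (induction k)
  case 0
  with nz show ?case
    by (auto intro: continuous_on_inverse)
next
  case (Suc k)
  from Suc.prems obtain f' where f': "\<And>x. x \<in> S \<Longrightarrow> (f has_derivative f' x) (at x within S)"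
    "\<And>v. v \<in> V \<Longrightarrow> Ck_on k V S (\<lambda>x. f' x v)"
    by (metis Ck_on_SucE)
  show ?case
    by (rule Ck_onI_derivative[OF Deriv.has_derivative_inverse[OF nz f'(1)]])
      (auto intro!: Ck_on_uminus Ck_on_mult Suc.IH f'(2) Ck_on_SucD[OF Suc.prems])
qed

lemma Ck_on_divide:
  fixes f g :: "'a::real_normed_vector \<Rightarrow> real"
  assumes "Ck_on k V S f" "Ck_on k V S g" "\<And>x. x \<in> S \<Longrightarrow> g x \<noteq> 0"
  shows "Ck_on k V S (\<lambda>x. f x / g x)"
  unfolding divide_inverse by (intro Ck_on_mult Ck_on_inverse assms)

text \<open>Again the derivative contains the function itself, now as a reciprocal; positivity keeps
  the root away from zero, so \<open>Ck_on_inverse\<close> applies to it at lower order.\<close>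

lemma Ck_on_sqrt:
  fixes f :: "'a::real_normed_vector \<Rightarrow> real"
  assumes f: "Ck_on k V S f" and pos: "\<And>x. x \<in> S \<Longrightarrow> 0 < f x"
  shows "Ck_on k V S (\<lambda>x. sqrt (f x))"
  using f
proof (induction k)
  case 0
  then show ?case
    by (auto intro: continuous_on_real_sqrt)
next
  case (Suc k)
  from Suc.prems obtain f' where f': "\<And>x. x \<in> S \<Longrightarrow> (f has_derivative f' x) (at x within S)"
    "\<And>v. v \<in> V \<Longrightarrow> Ck_on k V S (\<lambda>x. f' x v)"
    by (metis Ck_on_SucE)
  have "sqrt (f x) \<noteq> 0" if "x \<in> S" for x
    using pos[OF that] by simp
  with Suc.IH[OF Ck_on_SucD[OF Suc.prems]] have inv: "Ck_on k V S (\<lambda>x. inverse (sqrt (f x)))"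
    by (rule Ck_on_inverse)
  show ?case
  proof (rule Ck_onI_derivative)
    show "((\<lambda>x. sqrt (f x)) has_derivative (\<lambda>v. f' x v * (inverse (sqrt (f x)) * (1/2)))) (at x within S)"
      if "x \<in> S" for x
      using has_derivative_real_sqrt[OF pos f'(1)] that by (simp add: field_simps)
    show "Ck_on k V S (\<lambda>x. f' x v * (inverse (sqrt (f x)) * (1/2)))" if "v \<in> V" for v
      by (intro Ck_on_mult Ck_on_const inv f'(2) that)
  qed
qed

section \<open>Smoothness of matrix-valued maps and of maps given by procedures\<close>

lemma bounded_linear_entry: "bounded_linear (\<lambda>A :: real^'n^'m. A $ i $ j)"
  by (intro bounded_linear_compose[OF bounded_linear_vec_nth bounded_linear_vec_nth])

lemma matrix_expansion:
  "A = (\<Sum>i\<in>UNIV. \<Sum>j\<in>UNIV. A $ i $ j *\<^sub>R axis i (axis j 1))" for A :: "real^'n^'m"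
proof -
  have "(\<Sum>i\<in>UNIV. \<Sum>j\<in>UNIV. A $ i $ j *\<^sub>R axis i (axis j 1)) $ a $ b =
      (\<Sum>i\<in>UNIV. \<Sum>j\<in>UNIV. if b = j then (if a = i then A $ i $ j else 0) else 0)" for a b
    unfolding sum_component by (intro sum.cong) (auto simp: axis_def)
  then show ?thesis
    by (simp add: vec_eq_iff)
qed

lemma Ck_on_matrix:
  fixes f :: "'a::real_normed_vector \<Rightarrow> real^'n^'m"
  assumes "\<And>i j. Ck_on k V S (\<lambda>x. f x $ i $ j)"
  shows "Ck_on k V S f"
proof -
  have "Ck_on k V S (\<lambda>x. \<Sum>i\<in>UNIV. \<Sum>j\<in>UNIV. f x $ i $ j *\<^sub>R (axis i (axis j 1) :: real^'n^'m))"
    by (intro Ck_on_sum Ck_on_compose_linear[OF bounded_linear_scaleR_left] assms)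
  then show ?thesis
    by (rule Ck_on_cong) (rule matrix_expansion[symmetric])
qed

lemma smooth_on_bounded_linear: "bounded_linear h \<Longrightarrow> smooth_on V S h"
  by (simp add: smooth_on_def Ck_on_bounded_linear)

lemma smooth_on_Phi_upper: "smooth_on V S (Phi_upper C)"
proof -
  have "Ck_on k V S (\<lambda>L. \<Sum>m\<in>UNIV. (\<Sum>l\<in>UNIV. L $ l $ i * C $ l $ m) * L $ m $ j)" for k i j
    by (intro Ck_on_sum Ck_on_mult Ck_on_const Ck_on_bounded_linear bounded_linear_entry)
  then show ?thesis
    unfolding smooth_on_def
    by (intro allI Ck_on_matrix) (simp add: Phi_upper_def matrix_matrix_mult_def transpose_def)
qed

text \<open>A successful run certifies exactly the side conditions of the calculus: nonzero divisors
  and positive radicands at every point of \<open>T\<close>.\<close>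

lemma computes_Ck_on:
  assumes "\<And>A. A \<in> T \<Longrightarrow> computes A C e (f A)"
  shows "Ck_on k V T f"
  using assms
proof (induction e arbitrary: f)
  case (First_Entry i j)
  have "A $ i $ j = f A" if "A \<in> T" for A
    using First_Entry[OF that] by (auto elim: computes.cases)
  then show ?case
    by (rule Ck_on_cong[OF Ck_on_bounded_linear[OF bounded_linear_entry]])
next
  case (Second_Entry i j)
  have "C $ i $ j = f A" if "A \<in> T" for A
    using Second_Entry[OF that] by (auto elim: computes.cases)
  then show ?case
    by (rule Ck_on_cong[OF Ck_on_const])
next
  case One
  have "1 = f A" if "A \<in> T" for A
    using One[OF that] by (auto elim: computes.cases)
  then show ?case
    by (rule Ck_on_cong[OF Ck_on_const])
next
  case (Plus e e')
  \<comment> \<open>Inverting the run at each matrix and then choosing turns the intermediate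
    results into functions on \<open>T\<close>, to which the induction hypotheses apply.\<close>
  have "\<exists>r r'. computes A C e r \<and> computes A C e' r' \<and> f A = r + r'" if "A \<in> T" for A
    using Plus.prems[OF that] by cases blast
  then obtain r r' where *: "\<And>A. A \<in> T \<Longrightarrow> computes A C e (r A)"
    "\<And>A. A \<in> T \<Longrightarrow> computes A C e' (r' A)" "\<And>A. A \<in> T \<Longrightarrow> f A = r A + r' A"
    by metis
  show ?case
    by (rule Ck_on_cong[OF Ck_on_add[OF Plus.IH(1)[OF *(1)] Plus.IH(2)[OF *(2)]] *(3)[symmetric]])
next
  case (Minus e e')
  have "\<exists>r r'. computes A C e r \<and> computes A C e' r' \<and> f A = r - r'" if "A \<in> T" for A
    using Minus.prems[OF that] by cases blast
  then obtain r r' where *: "\<And>A. A \<in> T \<Longrightarrow> computes A C e (r A)"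
    "\<And>A. A \<in> T \<Longrightarrow> computes A C e' (r' A)" "\<And>A. A \<in> T \<Longrightarrow> f A = r A - r' A"
    by metis
  show ?case
    by (rule Ck_on_cong[OF Ck_on_diff[OF Minus.IH(1)[OF *(1)] Minus.IH(2)[OF *(2)]] *(3)[symmetric]])
next
  case (Times e e')
  have "\<exists>r r'. computes A C e r \<and> computes A C e' r' \<and> f A = r * r'" if "A \<in> T" for A
    using Times.prems[OF that] by cases blast
  then obtain r r' where *: "\<And>A. A \<in> T \<Longrightarrow> computes A C e (r A)"
    "\<And>A. A \<in> T \<Longrightarrow> computes A C e' (r' A)" "\<And>A. A \<in> T \<Longrightarrow> f A = r A * r' A"
    by metis
  show ?case
    by (rule Ck_on_cong[OF Ck_on_mult[OF Times.IH(1)[OF *(1)] Times.IH(2)[OF *(2)]] *(3)[symmetric]])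
next
  case (Divide e e')
  have "\<exists>r r'. computes A C e r \<and> computes A C e' r' \<and> r' \<noteq> 0 \<and> f A = r / r'" if "A \<in> T" for A
    using Divide.prems[OF that] by cases blast
  then obtain r r' where *: "\<And>A. A \<in> T \<Longrightarrow> computes A C e (r A)"
    "\<And>A. A \<in> T \<Longrightarrow> computes A C e' (r' A)" "\<And>A. A \<in> T \<Longrightarrow> r' A \<noteq> 0"
    "\<And>A. A \<in> T \<Longrightarrow> f A = r A / r' A"
    by metis
  show ?case
    by (rule Ck_on_cong[OF Ck_on_divide[OF Divide.IH(1)[OF *(1)] Divide.IH(2)[OF *(2)] *(3)] *(4)[symmetric]])
next
  case (Sqrt e)
  have "\<exists>r. computes A C e r \<and> 0 < r \<and> f A = sqrt r" if "A \<in> T" for A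
    using Sqrt.prems[OF that] by cases blast
  then obtain r where *: "\<And>A. A \<in> T \<Longrightarrow> computes A C e (r A)"
    "\<And>A. A \<in> T \<Longrightarrow> 0 < r A" "\<And>A. A \<in> T \<Longrightarrow> f A = sqrt (r A)"
    by metis
  show ?case
    by (rule Ck_on_cong[OF Ck_on_sqrt[OF Sqrt.IH[OF *(1)] *(2)] *(3)[symmetric]])
qed


section \<open>The algorithm\<close>

text \<open>The tree is quantified before the matrices, so a single procedure must serve the whole
  domain \<open>P\<close>.\<close>

definition computable where
  "computable P f \<longleftrightarrow> (\<exists>e. \<forall>A C. P A C \<longrightarrow> computes A C e (f A C))"

lemma computable_entries:
  "computable P (\<lambda>A C. A $ i $ j)" "computable P (\<lambda>A C. C $ i $ j)"
  unfolding computable_def by (blast intro: computes.intros)+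

lemma computable_one: "computable P (\<lambda>A C. 1)"
  unfolding computable_def by (blast intro: computes.intros)

lemma computable_add: "computable P f \<Longrightarrow> computable P g \<Longrightarrow> computable P (\<lambda>A C. f A C + g A C)"
  unfolding computable_def by (meson computes.intros)

lemma computable_diff: "computable P f \<Longrightarrow> computable P g \<Longrightarrow> computable P (\<lambda>A C. f A C - g A C)"
  unfolding computable_def by (meson computes.intros)

lemma computable_mult: "computable P f \<Longrightarrow> computable P g \<Longrightarrow> computable P (\<lambda>A C. f A C * g A C)"
  unfolding computable_def by (meson computes.intros)

lemma computable_divide:
  "computable P f \<Longrightarrow> computable P g \<Longrightarrow> (\<And>A C. P A C \<Longrightarrow> g A C \<noteq> 0) \<Longrightarrow>
    computable P (\<lambda>A C. f A C / g A C)"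
  unfolding computable_def by (meson computes.intros)

lemma computable_sqrt:
  "computable P f \<Longrightarrow> (\<And>A C. P A C \<Longrightarrow> 0 < f A C) \<Longrightarrow> computable P (\<lambda>A C. sqrt (f A C))"
  unfolding computable_def by (meson computes.intros)

text \<open>Procedures have \<open>1\<close> as their only constant; zero, the value of an empty
  sum, is obtained as \<open>1 - 1\<close>.\<close>

lemma computable_zero: "computable P (\<lambda>A C. 0)"
  using computable_diff[OF computable_one computable_one] by simp

lemma computable_sum:
  assumes "finite I" "\<And>i. i \<in> I \<Longrightarrow> computable P (f i)"
  shows "computable P (\<lambda>A C. \<Sum>i\<in>I. f i A C)"
  using assms by (induction I) (auto intro: computable_zero computable_add)

text \<open>\<open>F\<close> selects one of the two inputs, so the lemma covers the elimination of
  \<open>A\<close> and of \<open>C\<close>. For a fixed index the recursion unfolds into a finite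
  tree.\<close>

lemma computable_reduced_entry:
  assumes "\<And>i j. computable P (\<lambda>A C. F A C $ i $ j)"
    and "\<And>A C i. P A C \<Longrightarrow> reduced_entry (F A C) i i \<noteq> 0"
  shows "computable P (\<lambda>A C. reduced_entry (F A C) i j)"
proof (induction i arbitrary: j rule: finite_linorder_induct_down)
  case (greater i j)
  show ?case
    unfolding reduced_entry.simps[of _ i j]
    by (intro computable_diff computable_sum computable_divide computable_mult assms greater) auto
qed

text \<open>The position of \<open>i\<close> relative to \<open>j\<close> is decided while the tree
  is chosen, so expressions without branching suffice.\<close>

lemma computable_unit_lower_factor:
  assumes "\<And>i j. computable P (\<lambda>A C. F A C $ i $ j)"
    and "\<And>A C i. P A C \<Longrightarrow> reduced_entry (F A C) i i \<noteq> 0"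
  shows "computable P (\<lambda>A C. unit_lower_factor (F A C) $ i $ j)"
proof -
  have "computable P (\<lambda>A C. reduced_entry (F A C) i j / reduced_entry (F A C) i i)"
    by (intro computable_divide computable_reduced_entry assms)
  then show ?thesis
    by (cases "j < i"; cases "i = j")
      (simp_all add: unit_lower_factor_def computable_zero computable_one)
qed

lemma computable_forward_solve:
  assumes "\<And>i j. computable P (\<lambda>A C. N A C $ i $ j)" "\<And>i j. computable P (\<lambda>A C. K A C $ i $ j)"
  shows "computable P (\<lambda>A C. forward_solve (N A C) (K A C) i j)"
proof (induction i rule: finite_linorder_induct)
  case (less i)
  show ?case
    unfolding forward_solve.simps[of _ _ i j]
    by (intro computable_diff computable_sum computable_mult assms less) auto
qed

text \<open>The pattern is existentially quantified inside the domain, which makes the tree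
  independent of it.\<close>

lemma computable_Phi_inverse:
  "computable (\<lambda>A C. \<exists>\<epsilon>. A \<in> TPM \<epsilon> \<and> C \<in> TPM \<epsilon>) (\<lambda>A C. Phi_inverse C A $ i $ j)"
proof -
  have *: "computable (\<lambda>A C. \<exists>\<epsilon>. A \<in> TPM \<epsilon> \<and> C \<in> TPM \<epsilon>)
      (\<lambda>A C. sqrt (reduced_entry A i i / reduced_entry C i i) * unit_lower_factor A $ i $ j)" for i j
    by (intro computable_mult computable_sqrt computable_divide computable_unit_lower_factor
        computable_reduced_entry computable_entries)
      (auto simp: reduced_diag_nonzero reduced_ratio_pos simp del: divide_pos_pos)
  show ?thesis
    unfolding Phi_inverse_def vec_lambda_beta
    by (intro computable_forward_solve computable_unit_lower_factor computable_entries)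
      (auto simp: reduced_diag_nonzero *)
qed

lemma Phi_inverse_algorithm:
  "\<exists>algorithm :: 'n::{finite,linorder} \<Rightarrow> 'n \<Rightarrow> 'n procedure.
     \<forall>\<epsilon>. \<forall>C\<in>TPM \<epsilon>. \<forall>A\<in>TPM \<epsilon>. \<forall>i j. computes A C (algorithm i j) (Phi_inverse C A $ i $ j)"
proof -
  have "\<exists>e. \<forall>A C. (\<exists>\<epsilon>. A \<in> TPM \<epsilon> \<and> C \<in> TPM \<epsilon>) \<longrightarrow>
      computes A C e (Phi_inverse C A $ i $ j)" for i j :: 'n
    by (rule computable_Phi_inverse[unfolded computable_def])
  then obtain algorithm :: "'n \<Rightarrow> 'n \<Rightarrow> 'n procedure" where *:
    "\<And>i j. \<forall>A C. (\<exists>\<epsilon>. A \<in> TPM \<epsilon> \<and> C \<in> TPM \<epsilon>) \<longrightarrow>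
      computes A C (algorithm i j) (Phi_inverse C A $ i $ j)"
    by metis
  show ?thesis
    by (intro exI[of _ algorithm] allI ballI *[rule_format] exI conjI)
qed


section \<open>Diffeomorphisms and measurable sets\<close>

lemma diffeomorphism_onI:
  assumes "subspace V" "openin (top_of_set V) S" "subspace W" "openin (top_of_set W) T"
    and f: "\<And>x. x \<in> S \<Longrightarrow> f x \<in> T" and g: "\<And>y. y \<in> T \<Longrightarrow> g y \<in> S"
    and gf: "\<And>x. x \<in> S \<Longrightarrow> g (f x) = x" and fg: "\<And>y. y \<in> T \<Longrightarrow> f (g y) = y"
    and smooth: "smooth_on V S f" "smooth_on W T g"
  shows "diffeomorphism_on V S W T f"
proof -
  have bij: "bij_betw f S T"
    using f g gf fg by (intro bij_betw_byWitness[where f' = g]) auto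
  \<comment> \<open>The two inverses are compared on \<open>T\<close> only, which is all that
    \<open>Ck_on_cong\<close> asks for.\<close>
  have "g y = inv_into S f y" if "y \<in> T" for y
    using bij_betw_inv_into_left[OF bij g[OF that]] fg[OF that] by simp
  then have "smooth_on W T (inv_into S f)"
    using smooth(2) unfolding smooth_on_def by (blast intro: Ck_on_cong)
  with assms bij show ?thesis
    by (simp add: diffeomorphism_on_def)
qed

lemma diffeomorphism_onD:
  assumes "diffeomorphism_on V S W T f"
  shows "subspace V" "openin (top_of_set V) S" "subspace W" "openin (top_of_set W) T"
    and "bij_betw f S T" "smooth_on V S f" "smooth_on W T (inv_into S f)" "S \<subseteq> V" "T \<subseteq> W"
    and "f ` S = T" "inv_into S f ` T = S"
    and "\<And>x. x \<in> S \<Longrightarrow> inv_into S f (f x) = x" "\<And>y. y \<in> T \<Longrightarrow> f (inv_into S f y) = y"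
proof -
  show bij: "bij_betw f S T"
    using assms by (simp add: diffeomorphism_on_def)
  show "f ` S = T"
    by (rule bij_betw_imp_surj_on[OF bij])
  show "inv_into S f ` T = S"
    by (rule bij_betw_imp_surj_on[OF bij_betw_inv_into[OF bij]])
  show "inv_into S f (f x) = x" if "x \<in> S" for x
    using bij that by (rule bij_betw_inv_into_left)
  show "f (inv_into S f y) = y" if "y \<in> T" for y
    using bij that by (rule bij_betw_inv_into_right)
qed (use assms in \<open>auto simp: diffeomorphism_on_def dest: openin_imp_subset\<close>)

section \<open>Transport of Borel sets\<close>

lemma smooth_on_imp_continuous_on: "smooth_on V S f \<Longrightarrow> continuous_on S f"
  unfolding smooth_on_def by (metis Ck_on.simps(1))

text \<open>A subspace of a Euclidean space is closed and hence Borel, so its relative Borel sets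
  are the ambient Borel sets contained in it.\<close>

lemma borel_subsets_eq:
  fixes V :: "'a::euclidean_space set"
  assumes "subspace V" "S \<subseteq> V"
  shows "borel_subsets V S = {B \<in> sets borel. B \<subseteq> S}"
proof -
  have "V \<in> sets borel"
    using closed_subspace[OF assms(1)] by (rule borel_closed)
  then show ?thesis
    using assms(2) by (auto simp: borel_subsets_def sets_restrict_space_iff)
qed

lemma openin_subspace_borel:
  fixes V :: "'a::euclidean_space set"
  assumes "subspace V" "openin (top_of_set V) S"
  shows "S \<in> sets borel"
proof -
  obtain U where "open U" "S = V \<inter> U"
    using assms(2) by (auto simp: openin_open)
  then show ?thesis
    using borel_closed[OF closed_subspace[OF assms(1)]] by auto
qed

text \<open>The image under \<open>f\<close> is a preimage under the continuous inverse
  \<open>g\<close>, and preimages preserve measurability.\<close>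

lemma inverse_continuous_image_borel:
  fixes f :: "'a::topological_space \<Rightarrow> 'b::topological_space"
  assumes B: "B \<in> sets borel" "B \<subseteq> S" and T: "T \<in> sets borel" and g: "continuous_on T g"
    and "f ` S = T" "g ` T = S" "\<And>x. x \<in> S \<Longrightarrow> g (f x) = x" "\<And>y. y \<in> T \<Longrightarrow> f (g y) = y"
  shows "f ` B \<in> sets borel" "f ` B \<subseteq> T"
proof -
  have "f ` B = g -` B \<inter> T"
    using assms(2,5-) by force
  moreover have "g -` B \<inter> space (restrict_space borel T) \<in> sets (restrict_space borel T)"
    by (rule measurable_sets[OF borel_measurable_continuous_on_restrict[OF g] B(1)])
  ultimately show "f ` B \<in> sets borel"
    using T by (simp add: sets_restrict_space_iff)
  show "f ` B \<subseteq> T"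
    using assms(2,5) by auto
qed

lemma diffeomorphism_on_image_families:
  assumes "diffeomorphism_on V S W T f"
    and "\<And>B. B \<in> \<B> \<Longrightarrow> B \<subseteq> S \<and> f ` B \<in> \<C>"
    and "\<And>B. B \<in> \<C> \<Longrightarrow> B \<subseteq> T \<and> inv_into S f ` B \<in> \<B>"
  shows "(\<lambda>B. f ` B) ` \<B> = \<C>"
proof (intro subset_antisym subsetI)
  fix B assume "B \<in> \<C>"
  moreover from this have "f ` inv_into S f ` B = B"
    using assms(3)[of B] diffeomorphism_onD(13)[OF assms(1)] by force
  ultimately show "B \<in> (\<lambda>B. f ` B) ` \<B>"
    using assms(3) by (metis imageI)
qed (use assms(2) in auto)

lemma diffeomorphism_on_borel_subsets:
  fixes V :: "'a::euclidean_space set" and W :: "'b::euclidean_space set"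
  assumes "diffeomorphism_on V S W T f"
  shows "(\<lambda>B. f ` B) ` borel_subsets V S = borel_subsets W T"
proof (rule diffeomorphism_on_image_families[OF assms])
  note f = diffeomorphism_onD[OF assms]
  note eq = borel_subsets_eq[OF f(1,8)] borel_subsets_eq[OF f(3,9)]
  note S = openin_subspace_borel[OF f(1,2)] and T = openin_subspace_borel[OF f(3,4)]
  note cont = smooth_on_imp_continuous_on[OF f(6)] smooth_on_imp_continuous_on[OF f(7)]
  show "B \<subseteq> S \<and> f ` B \<in> borel_subsets W T" if "B \<in> borel_subsets V S" for B
    using that inverse_continuous_image_borel[OF _ _ T cont(2) f(10,11,12,13)] by (simp add: eq)
  show "B \<subseteq> T \<and> inv_into S f ` B \<in> borel_subsets V S" if "B \<in> borel_subsets W T" for B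
    using that inverse_continuous_image_borel[OF _ _ S cont(1) f(11,10,13,12)] by (simp add: eq)
qed

section \<open>Transport of Lebesgue sets in triangular coordinates\<close>

lemma bounded_linear_tri_coords: "bounded_linear tri_coords"
  unfolding linear_conv_bounded_linear[symmetric]
  by (rule linearI) (simp_all add: tri_coords_def vec_eq_iff)

text \<open>\<open>e\<close> is a linear map that rebuilds the matrices in \<open>S\<close> from
  their coordinates. Leaving it open lets the lemma treat both the congruence map, defined on
  triangular matrices, and its inverse, defined on symmetric ones.\<close>

lemma smooth_on_image_tri_coords_lebesgue:
  fixes f :: "(real, 'n::{finite,linorder}) sqmat \<Rightarrow> (real, 'n) sqmat"
    and e :: "real^('n tri_index) \<Rightarrow> (real, 'n) sqmat"
  assumes f: "smooth_on V S f" and e: "bounded_linear e" "\<And>A. A \<in> S \<Longrightarrow> e (tri_coords A) = A"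
    and B: "B \<subseteq> S" "tri_coords ` B \<in> sets lebesgue"
  shows "tri_coords ` f ` B \<in> sets lebesgue"
proof -
  let ?F = "\<lambda>u. tri_coords (f (e u))"
  have "Ck_on (Suc 0) V S f"
    using f unfolding smooth_on_def ..
  then obtain f' where f': "\<And>x. x \<in> S \<Longrightarrow> (f has_derivative f' x) (at x within S)"
    by (metis Ck_on_SucE)
  have sub: "e ` tri_coords ` B \<subseteq> S"
    using B(1) e(2) by auto
  have "?F differentiable_on tri_coords ` B"
    unfolding differentiable_on_def differentiable_def
  proof
    fix u assume u: "u \<in> tri_coords ` B"
    have "((\<lambda>u. f (e u)) has_derivative (\<lambda>y. f' (e u) (e y))) (at u within tri_coords ` B)"
      by (rule has_derivative_in_compose2[OF f' sub u bounded_linear_imp_has_derivative[OF e(1)]])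
    from bounded_linear.has_derivative[OF bounded_linear_tri_coords this]
    show "\<exists>D. (?F has_derivative D) (at u within tri_coords ` B)"
      by blast
  qed
  \<comment> \<open>\<open>order_refl\<close> discharges the dimension condition: source and target
    are the same coordinate space.\<close>
  then have "?F ` tri_coords ` B \<in> sets lebesgue"
    by (rule differentiable_image_in_sets_lebesgue[OF B(2) order_refl])
  moreover have "?F ` tri_coords ` B = tri_coords ` f ` B"
    unfolding image_image using B(1) e(2) by (intro image_cong) auto
  ultimately show ?thesis
    by simp
qed

definition lower_of_coords :: "real^('n::{finite,linorder} tri_index) \<Rightarrow> (real, 'n) sqmat" where
  "lower_of_coords u = (\<chi> i j. if j \<le> i then u $ Abs_tri_index (i, j) else 0)"

text \<open>Ordering the pair by \<open>max\<close> and \<open>min\<close> keeps it on or below the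
  diagonal, where \<open>Abs_tri_index\<close> is meaningful.\<close>

definition symmetric_of_coords :: "real^('n::{finite,linorder} tri_index) \<Rightarrow> (real, 'n) sqmat" where
  "symmetric_of_coords u = (\<chi> i j. u $ Abs_tri_index (max i j, min i j))"

lemma bounded_linear_of_coords:
  "bounded_linear lower_of_coords" "bounded_linear symmetric_of_coords"
  unfolding linear_conv_bounded_linear[symmetric]
  by (rule linearI; simp add: lower_of_coords_def symmetric_of_coords_def vec_eq_iff)+

lemma tri_coords_Abs: "j \<le> i \<Longrightarrow> tri_coords A $ Abs_tri_index (i, j) = A $ i $ j"
  by (simp add: tri_coords_def Abs_tri_index_inverse)

lemma of_coords_tri_coords:
  "A \<in> lower_triangular_matrices \<Longrightarrow> lower_of_coords (tri_coords A) = A"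
  "A \<in> symmetric_matrices \<Longrightarrow> symmetric_of_coords (tri_coords A) = A"
proof -
  show "lower_of_coords (tri_coords A) = A" if "A \<in> lower_triangular_matrices"
    using lower_triangularD[OF that]
    by (simp add: vec_eq_iff lower_of_coords_def tri_coords_Abs not_le)
  show "symmetric_of_coords (tri_coords A) = A" if "A \<in> symmetric_matrices"
    using symmetric_matricesD[OF that]
    by (simp add: vec_eq_iff symmetric_of_coords_def tri_coords_Abs max_def min_def)
qed

lemma diffeomorphism_on_lebesgue_subsets:
  fixes f :: "(real, 'n::{finite,linorder}) sqmat \<Rightarrow> (real, 'n) sqmat"
  assumes "diffeomorphism_on lower_triangular_matrices S symmetric_matrices T f"
  shows "(\<lambda>B. f ` B) ` lebesgue_subsets S = lebesgue_subsets T"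
proof (rule diffeomorphism_on_image_families[OF assms])
  note f = diffeomorphism_onD[OF assms]
  show "B \<subseteq> S \<and> f ` B \<in> lebesgue_subsets T" if "B \<in> lebesgue_subsets S" for B
  proof -
    have B: "B \<subseteq> S" "tri_coords ` B \<in> sets lebesgue"
      using that by (simp_all add: lebesgue_subsets_def)
    have "lower_of_coords (tri_coords A) = A" if "A \<in> S" for A
      using f(8) that by (intro of_coords_tri_coords) auto
    from smooth_on_image_tri_coords_lebesgue[OF f(6) bounded_linear_of_coords(1) this B] f(10) B(1)
    show ?thesis
      unfolding lebesgue_subsets_def by blast
  qed
  show "B \<subseteq> T \<and> inv_into S f ` B \<in> lebesgue_subsets S" if "B \<in> lebesgue_subsets T" for B
  proof -
    have B: "B \<subseteq> T" "tri_coords ` B \<in> sets lebesgue"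
      using that by (simp_all add: lebesgue_subsets_def)
    have "symmetric_of_coords (tri_coords A) = A" if "A \<in> T" for A
      using f(9) that by (intro of_coords_tri_coords) auto
    from smooth_on_image_tri_coords_lebesgue[OF f(7) bounded_linear_of_coords(2) this B] f(11) B(1)
    show ?thesis
      unfolding lebesgue_subsets_def by blast
  qed
qed

section \<open>Relative openness and the congruence diffeomorphism\<close>

lemma subspace_lower_triangular: "subspace lower_triangular_matrices"
  by (auto simp: subspace_def lower_triangular_matrices_def)

lemma subspace_symmetric: "subspace symmetric_matrices"
  by (auto simp: subspace_def symmetric_matrices_def transpose_def vec_eq_iff)

lemma openin_pos_lower_triangular:
  "openin (top_of_set lower_triangular_matrices)
    (pos_lower_triangular :: ((real, 'n::{finite,linorder}) sqmat) set)"
proof -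
  have op: "open (\<Inter>i. {L :: (real, 'n) sqmat. 0 < L $ i $ i})"
    by (intro open_INT finite ballI open_Collect_less continuous_intros)
  have eq: "pos_lower_triangular =
      lower_triangular_matrices \<inter> (\<Inter>i. {L :: (real, 'n) sqmat. 0 < L $ i $ i})"
    by (auto simp: pos_lower_triangular_def)
  show ?thesis
    unfolding eq using op by (rule openin_open_Int)
qed

lemma sign_patternsD: "\<epsilon> \<in> sign_patterns n \<Longrightarrow> k \<in> {1..n} \<Longrightarrow> \<epsilon> k = 1 \<or> \<epsilon> k = -1"
  using PiE_mem[of \<epsilon> "{1..n}" "\<lambda>_. {1, -1}" k] by (simp add: sign_patterns_def)

text \<open>Since a pattern takes only the values \<open>1\<close> and \<open>-1\<close>, each sign
  condition is a strict inequality \<open>0 < \<epsilon> k * minor\<close>, and there are finitely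
  many of them. A general \<open>I\<close> covers leading and trailing minors.\<close>

lemma openin_minor_signs:
  fixes I :: "nat \<Rightarrow> 'n::{finite,linorder} set"
  assumes "\<epsilon> \<in> sign_patterns n"
  shows "openin (top_of_set symmetric_matrices) {A \<in> symmetric_matrices. \<forall>k\<in>{1..n}.
     principal_minor (I k) A \<noteq> 0 \<and> sgn (principal_minor (I k) A) = \<epsilon> k}"
    (is "openin _ ?T")
proof -
  have sgn_iff: "(x \<noteq> 0 \<and> sgn x = e) \<longleftrightarrow> 0 < e * x" if "e = 1 \<or> e = -1" for e x :: real
    using that by (auto simp: sgn_if)
  have op: "open (\<Inter>k\<in>{1..n}. {A. 0 < \<epsilon> k * principal_minor (I k) A})"
    by (intro open_INT finite_atLeastAtMost ballI open_Collect_less continuous_intros)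
  have eq: "?T = symmetric_matrices \<inter> (\<Inter>k\<in>{1..n}. {A. 0 < \<epsilon> k * principal_minor (I k) A})"
    using sgn_iff[OF sign_patternsD[OF assms]] by blast
  show ?thesis
    unfolding eq using op by (rule openin_open_Int)
qed

lemma openin_TPM: "\<epsilon> \<in> sign_patterns CARD('n) \<Longrightarrow>
    openin (top_of_set symmetric_matrices) (TPM \<epsilon> :: ((real, 'n::{finite,linorder}) sqmat) set)"
  unfolding TPM_def by (rule openin_minor_signs)

lemma openin_LPM: "\<epsilon> \<in> sign_patterns CARD('n) \<Longrightarrow>
    openin (top_of_set symmetric_matrices) (LPM \<epsilon> :: ((real, 'n::{finite,linorder}) sqmat) set)"
  unfolding LPM_def by (rule openin_minor_signs)

lemma Phi_inverse_Phi_upper: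
  assumes "C \<in> TPM \<epsilon>" "L \<in> pos_lower_triangular"
  shows "Phi_inverse C (Phi_upper C L) = L"
proof -
  note A = Phi_upper_TPM[OF assms]
  show ?thesis
    by (rule inj_onD[OF inj_on_Phi_upper[OF assms(1)] Phi_upper_Phi_inverse[OF A assms(1)]
          Phi_inverse_pos_lower[OF A assms(1)] assms(2)])
qed

lemma inv_into_Phi_upper:
  assumes "C \<in> TPM \<epsilon>" "A \<in> TPM \<epsilon>"
  shows "inv_into pos_lower_triangular (Phi_upper C) A = Phi_inverse C A"
  by (rule inv_into_f_eq[OF inj_on_Phi_upper[OF assms(1)] Phi_inverse_pos_lower[OF assms(2,1)]
        Phi_upper_Phi_inverse[OF assms(2,1)]])

lemma diffeomorphism_on_Phi_upper:
  fixes C :: "(real, 'n::{finite,linorder}) sqmat"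
  assumes \<epsilon>: "\<epsilon> \<in> sign_patterns CARD('n)" and C: "C \<in> TPM \<epsilon>"
  shows "diffeomorphism_on lower_triangular_matrices pos_lower_triangular
    symmetric_matrices (TPM \<epsilon>) (Phi_upper C)"
proof (rule diffeomorphism_onI[where g = "Phi_inverse C"])
  obtain algorithm :: "'n \<Rightarrow> 'n \<Rightarrow> 'n procedure" where
    "\<forall>\<epsilon>. \<forall>C\<in>TPM \<epsilon>. \<forall>A\<in>TPM \<epsilon>. \<forall>i j. computes A C (algorithm i j) (Phi_inverse C A $ i $ j)"
    using Phi_inverse_algorithm ..
  then have "computes A C (algorithm i j) (Phi_inverse C A $ i $ j)" if "A \<in> TPM \<epsilon>" for A i j
    using C that by simp
  then have "Ck_on k symmetric_matrices (TPM \<epsilon>) (Phi_inverse C)" for k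
    by (intro Ck_on_matrix) (rule computes_Ck_on)
  then show "smooth_on symmetric_matrices (TPM \<epsilon>) (Phi_inverse C)"
    by (simp add: smooth_on_def)
  show "openin (top_of_set symmetric_matrices) (TPM \<epsilon> :: ((real, 'n) sqmat) set)"
    by (rule openin_TPM[OF \<epsilon>])
  show "Phi_upper C L \<in> TPM \<epsilon>" "Phi_inverse C (Phi_upper C L) = L" if "L \<in> pos_lower_triangular" for L
    using Phi_upper_TPM[OF C that] Phi_inverse_Phi_upper[OF C that] by simp_all
  show "Phi_inverse C A \<in> pos_lower_triangular" "Phi_upper C (Phi_inverse C A) = A"
    if "A \<in> TPM \<epsilon>" for A
    using Phi_inverse_pos_lower[OF that C] Phi_upper_Phi_inverse[OF that C] by simp_all
qed (rule subspace_lower_triangular subspace_symmetric openin_pos_lower_triangular smooth_on_Phi_upper)+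


section \<open>Sign patterns\<close>

text \<open>The diagonal must have prescribed tail products. Its entries will be \<open>1\<close> or
  \<open>-1\<close>, so dividing by the later product is the same as multiplying by it.\<close>

function sign_diagonal :: "('n::{finite,linorder} \<Rightarrow> real) \<Rightarrow> 'n \<Rightarrow> real" where
  "sign_diagonal e i = e i * (\<Prod>k\<in>{i<..}. sign_diagonal e k)"
  by pat_completeness auto
termination
  by (relation "Wellfounded.measure (\<lambda>(e, i). card {i<..})") (auto intro: card_greaterThan_less)

declare sign_diagonal.simps [simp del]

text \<open>All entries square to one, so the later product, which occurs twice, cancels against
  itself.\<close>

lemma prod_sign_diagonal:
  assumes e: "\<And>i. (e i)\<^sup>2 = 1"
  shows "(\<Prod>k\<in>{i..}. sign_diagonal e k) = e i"
proof -
  have sq: "(sign_diagonal e i)\<^sup>2 = 1" for i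
  proof (induction i rule: finite_linorder_induct_down)
    case (greater i)
    then show ?case
      by (subst sign_diagonal.simps) (simp add: power_mult_distrib e prod_power_distrib)
  qed
  have "{i..} = insert i {i<..}"
    by auto
  then have "(\<Prod>k\<in>{i..}. sign_diagonal e k) = e i * (\<Prod>k\<in>{i<..}. sign_diagonal e k)\<^sup>2"
    using sign_diagonal.simps[of e i] by (simp add: power2_eq_square)
  then show ?thesis
    by (simp add: prod_power_distrib sq)
qed

lemma TPM_nonempty:
  assumes "\<epsilon> \<in> sign_patterns CARD('n)"
  shows "(TPM \<epsilon> :: ((real, 'n::{finite,linorder}) sqmat) set) \<noteq> {}"
proof -
  let ?e = "\<lambda>i :: 'n. \<epsilon> (CARD('n) + 1 - index_pos i)"
  have e: "?e i = 1 \<or> ?e i = -1" for i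
    using index_pos_bounds[of i] by (intro sign_patternsD[OF assms]) auto
  then have "(?e i)\<^sup>2 = 1" for i
    by (metis power2_minus one_power2)
  then have minor: "principal_minor {i..} (diagonal (sign_diagonal ?e)) = ?e i" for i
    by (simp only: principal_minor_diagonal prod_sign_diagonal)
  have "diagonal (sign_diagonal ?e) \<in> symmetric_matrices"
    by (rule symmetric_matricesI) (simp add: diagonal_def)
  moreover have "?e i \<noteq> 0 \<and> sgn (?e i) = ?e i" for i
    using e[of i] by auto
  ultimately have "diagonal (sign_diagonal ?e) \<in> TPM \<epsilon>"
    unfolding TPM_iff minor by blast
  then show ?thesis by blast
qed

lemma disjoint_TPM:
  "disjoint_family_on (TPM :: _ \<Rightarrow> ((real, 'n::{finite,linorder}) sqmat) set)
    (sign_patterns CARD('n))"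
proof (unfold disjoint_family_on_def, intro ballI impI)
  fix \<epsilon> \<epsilon>'
  assume *: "\<epsilon> \<in> sign_patterns CARD('n)" "\<epsilon>' \<in> sign_patterns CARD('n)" "\<epsilon> \<noteq> \<epsilon>'"
  have False if "(A :: (real, 'n) sqmat) \<in> TPM \<epsilon>" "A \<in> TPM \<epsilon>'" for A
  proof -
    have "\<epsilon> k = \<epsilon>' k" if "k \<in> {1..CARD('n)}" for k
      using that \<open>A \<in> TPM \<epsilon>\<close> \<open>A \<in> TPM \<epsilon>'\<close> by (auto simp: TPM_def)
    \<comment> \<open>Patterns are extensional, so agreement on \<open>{1..CARD('n)}\<close> already
      forces equality.\<close>
    with * show False
      unfolding sign_patterns_def by (metis PiE_ext)
  qed
  then show "(TPM \<epsilon> :: ((real, 'n) sqmat) set) \<inter> TPM \<epsilon>' = {}"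
    by blast
qed

text \<open>Evaluation at \<open>s\<close> is a ring homomorphism and minors make sense over any
  commutative ring, so a minor along a line of matrices is the value of one polynomial
  minor.\<close>

lemma principal_minor_polynomial:
  "poly (principal_minor I (\<chi> i j. [:A $ i $ j, B $ i $ j:])) s = principal_minor I (A + s *\<^sub>R B)"
  for A B :: "(real, 'n::finite) sqmat"
  by (simp add: principal_minor_def poly_sum poly_prod algebra_simps flip: of_int_poly)

lemma TPM_all_iff:
  "A \<in> TPM_all \<longleftrightarrow> A \<in> symmetric_matrices \<and>
    (\<forall>k\<in>{1..CARD('n)}. principal_minor (trailing_indices k) A \<noteq> 0)"
  for A :: "(real, 'n::{finite,linorder}) sqmat"
proof
  assume A: "A \<in> symmetric_matrices \<and>
    (\<forall>k\<in>{1..CARD('n)}. principal_minor (trailing_indices k) A \<noteq> 0)"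
  \<comment> \<open>The pattern is read off from \<open>A\<close>; \<open>restrict\<close> gives it
    the default value outside \<open>{1..CARD('n)}\<close> that membership in
    \<open>sign_patterns\<close> demands.\<close>
  let ?e = "restrict (\<lambda>k. sgn (principal_minor (trailing_indices k) A)) {1..CARD('n)}"
  have "?e \<in> sign_patterns CARD('n)"
    using A by (auto simp: sign_patterns_def sgn_if)
  moreover have "A \<in> TPM ?e"
    using A by (auto simp: TPM_def)
  ultimately show "A \<in> TPM_all"
    by (auto simp: TPM_all_def)
qed (auto simp: TPM_all_def TPM_def)

text \<open>The minors along the segment from \<open>A\<close> to the identity are polynomials that do not vanish at
  the identity, so they have no zeros near \<open>A\<close> except possibly at \<open>A\<close> itself.\<close>

lemma symmetric_subset_closure_TPM_all:
  "symmetric_matrices \<subseteq> closure (TPM_all :: ((real, 'n::{finite,linorder}) sqmat) set)"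
proof
  fix A :: "(real, 'n) sqmat"
  assume A: "A \<in> symmetric_matrices"
  let ?B = "mat 1 - A"
  let ?p = "\<lambda>k. principal_minor (trailing_indices k) (\<chi> i j. [:A $ i $ j, ?B $ i $ j:])"
  have one: "poly (?p k) 1 = 1" for k
    unfolding principal_minor_polynomial
    by (subst principal_minor_lower_triangular) (auto simp: mat_def)
  have "?p k \<noteq> 0" for k
  proof
    assume "?p k = 0"
    with one[of k] have "poly 0 (1 :: real) = 1"
      by (simp only:)
    then show False
      by simp
  qed
  then have fin: "finite (\<Union>k\<in>{1..CARD('n)}. {s. poly (?p k) s = 0})" (is "finite ?F")
    by (intro finite_UN_I finite_atLeastAtMost poly_roots_finite)
  have sym: "A + s *\<^sub>R ?B \<in> symmetric_matrices" for s
    using A by (auto simp: symmetric_matrices_def transpose_def vec_eq_iff mat_def)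
  have "open (- (?F - {0}))"
    using fin by (intro open_Compl finite_imp_closed) auto
  then have "eventually (\<lambda>s. s \<notin> ?F) (at 0)"
    unfolding eventually_at_topological by (intro exI[of _ "- (?F - {0})"]) auto
  then have "eventually (\<lambda>s. A + s *\<^sub>R ?B \<in> closure TPM_all) (at 0)"
  proof (rule eventually_mono)
    fix s assume "s \<notin> ?F"
    then have "A + s *\<^sub>R ?B \<in> TPM_all"
      unfolding TPM_all_iff using sym principal_minor_polynomial[of _ A ?B s] by auto
    then show "A + s *\<^sub>R ?B \<in> closure TPM_all"
      using closure_subset by blast
  qed
  moreover have "((\<lambda>s. A + s *\<^sub>R ?B) \<longlongrightarrow> A + 0 *\<^sub>R ?B) (at 0)"
    by (intro tendsto_intros)
  ultimately have "A + 0 *\<^sub>R ?B \<in> closure TPM_all"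
    by (intro Lim_in_closed_set[OF closed_closure]) auto
  then show "A \<in> closure TPM_all"
    by simp
qed

lemma TPM_all_dense:
  "top_of_set symmetric_matrices closure_of (TPM_all :: ((real, 'n::{finite,linorder}) sqmat) set) =
    symmetric_matrices"
proof -
  have "symmetric_matrices \<inter> TPM_all = (TPM_all :: ((real, 'n) sqmat) set)"
    by (auto simp: TPM_all_iff)
  then show ?thesis
    unfolding closure_of_subtopology euclidean_closure_of
    by (simp only: Int_absorb2[OF symmetric_subset_closure_TPM_all])
qed

lemma openin_TPM_all:
  "openin (top_of_set symmetric_matrices) (TPM_all :: ((real, 'n::{finite,linorder}) sqmat) set)"
  unfolding TPM_all_def using openin_TPM by (intro openin_Union) auto

text \<open>There are finitely many patterns, so the closures of the individual sets have a closed
  union. It contains the closure of \<open>TPM_all\<close>, hence \<open>A\<close> lies in the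
  closure for one fixed pattern.\<close>

lemma exists_TPM_sequence:
  fixes A :: "(real, 'n::{finite,linorder}) sqmat"
  assumes "A \<in> symmetric_matrices"
  shows "\<exists>\<epsilon>\<in>sign_patterns CARD('n). \<exists>X. (\<forall>m::nat. X m \<in> TPM \<epsilon>) \<and>
    (\<forall>i j. (\<lambda>m. X m $ i $ j) \<longlonglongrightarrow> A $ i $ j)"
proof -
  have "finite (sign_patterns CARD('n))"
    unfolding sign_patterns_def by (intro finite_PiE) auto
  then have "closed (\<Union>\<epsilon>\<in>sign_patterns CARD('n). closure (TPM \<epsilon> :: ((real, 'n) sqmat) set))"
    by (intro closed_UN) auto
  moreover have "TPM_all \<subseteq> (\<Union>\<epsilon>\<in>sign_patterns CARD('n). closure (TPM \<epsilon> :: ((real, 'n) sqmat) set))"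
    unfolding TPM_all_def using closure_subset by blast
  ultimately have "A \<in> (\<Union>\<epsilon>\<in>sign_patterns CARD('n). closure (TPM \<epsilon>))"
    using assms symmetric_subset_closure_TPM_all closure_minimal by blast
  then obtain \<epsilon> where \<epsilon>: "\<epsilon> \<in> sign_patterns CARD('n)" "A \<in> closure (TPM \<epsilon>)"
    by blast
  then obtain X where X: "\<And>m. X m \<in> TPM \<epsilon>" "X \<longlonglongrightarrow> A"
    unfolding closure_sequential by blast
  have "(\<lambda>m. X m $ i $ j) \<longlonglongrightarrow> A $ i $ j" for i j
    by (intro tendsto_vec_nth X(2))
  with \<epsilon>(1) X(1) show ?thesis
    by blast
qed


section \<open>Reversal\<close>

definition flip :: "'n::{finite,linorder} \<Rightarrow> 'n" where
  "flip i = inv_into UNIV index_pos (CARD('n) + 1 - index_pos i)"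

lemma index_pos_flip: "index_pos (flip i) = CARD('n) + 1 - index_pos i"
  for i :: "'n::{finite,linorder}"
proof -
  have "CARD('n) + 1 - index_pos i \<in> {1..CARD('n)}"
    using index_pos_bounds[of i] by auto
  then show ?thesis
    unfolding flip_def by (intro f_inv_into_f) (metis bij_betw_index_pos bij_betw_imp_surj_on)
qed

lemma index_pos_eq_flip: "index_pos u + index_pos v = CARD('n) + 1 \<longleftrightarrow> v = flip u"
  for u v :: "'n::{finite,linorder}"
proof -
  have "v = flip u \<longleftrightarrow> index_pos v = index_pos (flip u)"
    by (rule index_pos_eq_iff[symmetric])
  then show ?thesis
    using index_pos_bounds[of u] by (auto simp: index_pos_flip)
qed

lemma flip_flip [simp]: "flip (flip i) = i"
  by (metis index_pos_eq_flip add.commute)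

lemma flip_eq_iff [simp]: "flip i = flip j \<longleftrightarrow> i = j"
  by (metis flip_flip)

lemma flip_less_iff [simp]: "flip i < flip j \<longleftrightarrow> j < i"
  using index_pos_bounds[of i] index_pos_bounds[of j]
  by (simp add: index_pos_less_iff[symmetric] index_pos_flip) linarith

lemma flip_leading_iff: "flip i \<in> leading_indices k \<longleftrightarrow> i \<in> trailing_indices k"
  using index_pos_bounds[of i]
  by (auto simp: leading_indices_def trailing_indices_def index_pos_flip)

text \<open>Stated over a commutative ring so that it serves the complex reversal as well as the
  real one.\<close>

lemma antidiagonal_conjugate_entry:
  "(antidiagonal ** A ** antidiagonal) $ i $ j = A $ flip i $ flip j"
  for A :: "('a::comm_ring_1, 'n::{finite,linorder}) sqmat"
proof -
  have row: "antidiagonal $ u $ v = (if v = flip u then 1 else 0)" for u v :: 'n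
    unfolding antidiagonal_def vec_lambda_beta index_pos_eq_flip ..
  have col: "antidiagonal $ u $ v = (if u = flip v then 1 else 0)" for u v :: 'n
    unfolding row by (metis flip_flip)
  have "(antidiagonal ** A) $ i $ k = A $ flip i $ k" for k
    unfolding matrix_mult_entry row
    by (simp add: if_distrib[where f = "\<lambda>x. x * _"] cong: if_cong)
  then show ?thesis
    unfolding matrix_mult_entry[of "antidiagonal ** A"] col 
    by (simp add: if_distrib[where f = "\<lambda>x. _ * x"] cong: if_cong)
qed

lemma real_reversal_entry: "real_reversal A $ i $ j = A $ flip j $ flip i"
  by (simp add: real_reversal_def transpose_def antidiagonal_conjugate_entry)

lemma real_reversal_involution [simp]: "real_reversal (real_reversal A) = A"
  by (simp add: vec_eq_iff real_reversal_entry)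

lemma linear_real_reversal: "linear real_reversal"
  by (rule linearI) (simp_all add: vec_eq_iff real_reversal_entry)

lemma reversal_of_real:
  "reversal (map_matrix complex_of_real A) = map_matrix complex_of_real (real_reversal A)"
  by (simp add: vec_eq_iff reversal_def conjugate_transpose_def transpose_def real_reversal_entry
      antidiagonal_conjugate_entry)

text \<open>The antidiagonal matrix squares to the identity, so its determinant enters squared and
  equals one there; its sign is never computed.\<close>

lemma det_real_reversal: "det (real_reversal A) = det A"
proof -
  have "antidiagonal ** antidiagonal = (mat 1 :: (real, 'a) sqmat)"
  proof -
    have "antidiagonal ** mat 1 ** antidiagonal = (mat 1 :: (real, 'a) sqmat)"
      unfolding vec_eq_iff antidiagonal_conjugate_entry by (simp add: mat_def)
    then show ?thesis
      by simp
  qed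
  then have "det (antidiagonal :: (real, 'a) sqmat) * det (antidiagonal :: (real, 'a) sqmat) = 1"
    by (metis det_mul det_I)
  then show ?thesis
    by (simp add: real_reversal_def det_mul mult_ac)
qed

text \<open>Reversal carries the padded leading block to the padded trailing block, because
  \<open>flip\<close> exchanges the two index sets and preserves the diagonal.\<close>

lemma principal_minor_real_reversal:
  "principal_minor (trailing_indices k) (real_reversal A) = principal_minor (leading_indices k) A"
proof -
  have "i = j \<longleftrightarrow> flip j = flip i" for i j :: 'a
    by (metis flip_flip)
  then have "pad (trailing_indices k) (real_reversal A) = real_reversal (pad (leading_indices k) A)"
    by (auto simp: vec_eq_iff real_reversal_entry pad_def flip_leading_iff)
  then show ?thesis
    by (metis det_pad det_real_reversal)
qed

lemma real_reversal_symmetric: "A \<in> symmetric_matrices \<Longrightarrow> real_reversal A \<in> symmetric_matrices"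
  by (rule symmetric_matricesI) (simp add: real_reversal_entry symmetric_matricesD)

lemma real_reversal_symmetric_iff [simp]:
  "real_reversal A \<in> symmetric_matrices \<longleftrightarrow> A \<in> symmetric_matrices"
  by (metis real_reversal_symmetric real_reversal_involution)

lemma real_reversal_TPM_iff: "real_reversal A \<in> TPM \<epsilon> \<longleftrightarrow> A \<in> LPM \<epsilon>"
  by (simp add: TPM_def LPM_def principal_minor_real_reversal)

lemma real_reversal_LPM_iff: "real_reversal A \<in> LPM \<epsilon> \<longleftrightarrow> A \<in> TPM \<epsilon>"
  by (simp flip: real_reversal_TPM_iff)

lemma real_reversal_lower:
  "L \<in> lower_triangular_matrices \<Longrightarrow> real_reversal L \<in> lower_triangular_matrices"
  by (simp add: lower_triangular_matrices_def real_reversal_entry)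

lemma real_reversal_pos_lower:
  "L \<in> pos_lower_triangular \<Longrightarrow> real_reversal L \<in> pos_lower_triangular"
  by (simp add: pos_lower_triangular_def real_reversal_lower) (simp add: real_reversal_entry)

section \<open>Conjugating the congruence maps by reversal\<close>

lemma smooth_on_real_reversal: "smooth_on V S real_reversal"
  by (rule smooth_on_bounded_linear[OF linear_real_reversal[unfolded linear_conv_bounded_linear]])

lemma diffeomorphism_on_real_reversal:
  assumes "subspace V" "openin (top_of_set V) S" "subspace W" "openin (top_of_set W) T"
    and "\<And>A. A \<in> S \<Longrightarrow> real_reversal A \<in> T" "\<And>A. A \<in> T \<Longrightarrow> real_reversal A \<in> S"
  shows "diffeomorphism_on V S W T real_reversal"
  using assms by (intro diffeomorphism_onI[where g = real_reversal] smooth_on_real_reversal) auto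

text \<open>Conjugation by the antidiagonal preserves the order of factors and transposition
  reverses it. This anti-multiplicativity is what makes the square commute.\<close>

lemma real_reversal_mult: "real_reversal (X ** Y) = real_reversal Y ** real_reversal X"
proof -
  have "bij flip"
    by (rule involuntory_imp_bij) simp
  then have "(\<Sum>k\<in>UNIV. X $ flip j $ k * Y $ k $ flip i) =
      (\<Sum>k\<in>UNIV. X $ flip j $ flip k * Y $ flip k $ flip i)" for i j
    by (intro sum.reindex_bij_betw[symmetric, of flip UNIV UNIV "\<lambda>k. X $ flip j $ k * Y $ k $ flip i"])
  then show ?thesis
    by (simp add: vec_eq_iff real_reversal_entry matrix_mult_entry mult.commute)
qed

lemma real_reversal_transpose: "real_reversal (transpose X) = transpose (real_reversal X)"
  by (simp add: vec_eq_iff real_reversal_entry transpose_def)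

lemma real_reversal_Phi_lower:
  "real_reversal (Phi_lower B L) = Phi_upper (real_reversal B) (real_reversal L)"
  by (simp add: Phi_lower_def Phi_upper_def real_reversal_mult real_reversal_transpose
      matrix_mul_assoc)

lemma smooth_on_conjugate_real_reversal:
  assumes f: "smooth_on V S f" and "real_reversal ` S' \<subseteq> S" "real_reversal ` V' \<subseteq> V"
  shows "smooth_on V' S' (\<lambda>A. real_reversal (f (real_reversal A)))"
proof -
  note lin = linear_real_reversal[unfolded linear_conv_bounded_linear]
  have "Ck_on k V' S' (\<lambda>A. f (real_reversal A))" for k
    using f by (intro Ck_on_linear_compose[OF lin assms(2,3)]) (simp add: smooth_on_def)
  then show ?thesis
    unfolding smooth_on_def by (intro allI Ck_on_compose_linear[OF lin])
qed

text \<open>\<open>Phi_lower B\<close> is \<open>Phi_upper\<close> of the reversed matrix with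
  reversal applied before and after; bijectivity and the smooth inverse are inherited through this
  conjugation.\<close>

lemma diffeomorphism_on_Phi_lower:
  fixes B :: "(real, 'n::{finite,linorder}) sqmat"
  assumes \<epsilon>: "\<epsilon> \<in> sign_patterns CARD('n)" and B: "B \<in> LPM \<epsilon>"
  shows "diffeomorphism_on lower_triangular_matrices pos_lower_triangular
    symmetric_matrices (LPM \<epsilon>) (Phi_lower B)"
proof -
  let ?C = "real_reversal B" and ?S = "pos_lower_triangular :: ((real, 'n) sqmat) set"
  let ?g = "inv_into ?S (Phi_upper ?C)"
  have C: "?C \<in> TPM \<epsilon>"
    using B by (simp add: real_reversal_TPM_iff)
  note Phi = diffeomorphism_onD[OF diffeomorphism_on_Phi_upper[OF \<epsilon> C]]
  have eq: "Phi_lower B = (\<lambda>L. real_reversal (Phi_upper ?C (real_reversal L)))"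
    by (simp flip: real_reversal_Phi_lower)
  show ?thesis
    unfolding eq
  proof (rule diffeomorphism_onI[where g = "\<lambda>A. real_reversal (?g (real_reversal A))"])
    fix A :: "(real, 'n) sqmat" assume "A \<in> LPM \<epsilon>"
    then have "real_reversal A \<in> TPM \<epsilon>"
      by (simp add: real_reversal_TPM_iff)
    then show "real_reversal (?g (real_reversal A)) \<in> ?S"
      "real_reversal (Phi_upper ?C (real_reversal (real_reversal (?g (real_reversal A))))) = A"
      using Phi(11,13) by (auto intro!: real_reversal_pos_lower)
  next
    fix L :: "(real, 'n) sqmat" assume "L \<in> ?S"
    then have "real_reversal L \<in> ?S"
      by (rule real_reversal_pos_lower)
    then show "real_reversal (Phi_upper ?C (real_reversal L)) \<in> LPM \<epsilon>"
      "real_reversal (?g (real_reversal (real_reversal (Phi_upper ?C (real_reversal L))))) = L"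
      using Phi(10,12) by (auto simp: real_reversal_LPM_iff)
  next
    show "smooth_on lower_triangular_matrices ?S (\<lambda>L. real_reversal (Phi_upper ?C (real_reversal L)))"
      by (rule smooth_on_conjugate_real_reversal[OF Phi(6)])
        (auto intro: real_reversal_lower real_reversal_pos_lower)
    show "smooth_on symmetric_matrices (LPM \<epsilon>) (\<lambda>A. real_reversal (?g (real_reversal A)))"
      by (rule smooth_on_conjugate_real_reversal[OF Phi(7)]) (auto simp: real_reversal_TPM_iff)
  qed (use \<epsilon> in \<open>simp_all add: subspace_lower_triangular subspace_symmetric openin_LPM
        openin_pos_lower_triangular\<close>)
qed

theorem theorem1p8:
  shows
    "(\<forall>\<epsilon>\<in>sign_patterns CARD('n). (TPM \<epsilon> :: ((real, 'n::{finite,linorder}) sqmat) set) \<noteq> {}) \<and>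
     disjoint_family_on (TPM :: _ \<Rightarrow> ((real, 'n) sqmat) set) (sign_patterns CARD('n)) \<and>
     openin (top_of_set symmetric_matrices) (TPM_all :: ((real, 'n) sqmat) set) \<and>
     top_of_set symmetric_matrices closure_of (TPM_all :: ((real, 'n) sqmat) set) = symmetric_matrices \<and>
     (\<forall>A :: (real, 'n) sqmat. A \<in> symmetric_matrices \<longrightarrow>
        (\<exists>\<epsilon>\<in>sign_patterns CARD('n). \<exists>X. (\<forall>m::nat. X m \<in> TPM \<epsilon>) \<and>
           (\<forall>i j. (\<lambda>m. X m $ i $ j) \<longlonglongrightarrow> A $ i $ j))) \<and>

     (\<exists>algorithm :: 'n \<Rightarrow> 'n \<Rightarrow> 'n procedure.
       \<forall>\<epsilon>\<in>sign_patterns CARD('n). \<forall>C :: (real, 'n) sqmat. C \<in> TPM \<epsilon> \<longrightarrow>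
         diffeomorphism_on lower_triangular_matrices pos_lower_triangular
           symmetric_matrices (TPM \<epsilon>) (Phi_upper C) \<and>
         (\<forall>A\<in>TPM \<epsilon>. \<forall>i j.
            computes A C (algorithm i j) (inv_into pos_lower_triangular (Phi_upper C) A $ i $ j)) \<and>
         (\<lambda>B. Phi_upper C ` B) ` borel_subsets lower_triangular_matrices pos_lower_triangular =
           borel_subsets symmetric_matrices (TPM \<epsilon>) \<and>
         (\<lambda>B. Phi_upper C ` B) ` lebesgue_subsets pos_lower_triangular =
           lebesgue_subsets (TPM \<epsilon>)) \<and>

     (\<forall>A :: (real, 'n) sqmat. reversal (map_matrix complex_of_real A) =
        map_matrix complex_of_real (real_reversal A)) \<and>
     linear (real_reversal :: (real, 'n) sqmat \<Rightarrow> (real, 'n) sqmat) \<and>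
     (\<forall>\<epsilon>\<in>sign_patterns CARD('n).
        diffeomorphism_on symmetric_matrices (LPM \<epsilon>) symmetric_matrices (TPM \<epsilon>)
          (real_reversal :: (real, 'n) sqmat \<Rightarrow> (real, 'n) sqmat) \<and>
        diffeomorphism_on symmetric_matrices (TPM \<epsilon>) symmetric_matrices (LPM \<epsilon>)
          (real_reversal :: (real, 'n) sqmat \<Rightarrow> (real, 'n) sqmat) \<and>
        (\<forall>A :: (real, 'n) sqmat. A \<in> LPM \<epsilon> \<union> TPM \<epsilon> \<longrightarrow> real_reversal (real_reversal A) = A) \<and>
        (\<forall>B :: (real, 'n) sqmat. B \<in> LPM \<epsilon> \<longrightarrow>
           diffeomorphism_on lower_triangular_matrices pos_lower_triangular
             lower_triangular_matrices pos_lower_triangular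
             (real_reversal :: (real, 'n) sqmat \<Rightarrow> (real, 'n) sqmat) \<and>
           diffeomorphism_on lower_triangular_matrices pos_lower_triangular
             symmetric_matrices (LPM \<epsilon>) (Phi_lower B) \<and>
           diffeomorphism_on lower_triangular_matrices pos_lower_triangular
             symmetric_matrices (TPM \<epsilon>) (Phi_upper (real_reversal B)) \<and>
           (\<forall>L\<in>pos_lower_triangular.
              real_reversal (Phi_lower B L) = Phi_upper (real_reversal B) (real_reversal L))))"
proof (intro conjI)
  \<comment> \<open>The trees are fixed before pattern and \<open>C\<close>, so one algorithm serves
    every instance; \<open>inv_into_Phi_upper\<close> then identifies its output with the abstract
    inverse.\<close>
  obtain algorithm :: "'n \<Rightarrow> 'n \<Rightarrow> 'n procedure" where algorithm:
    "\<forall>\<epsilon>. \<forall>C\<in>TPM \<epsilon>. \<forall>A\<in>TPM \<epsilon>. \<forall>i j. computes A C (algorithm i j) (Phi_inverse C A $ i $ j)"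
    using Phi_inverse_algorithm ..
  show "\<exists>algorithm :: 'n \<Rightarrow> 'n \<Rightarrow> 'n procedure.
       \<forall>\<epsilon>\<in>sign_patterns CARD('n). \<forall>C :: (real, 'n) sqmat. C \<in> TPM \<epsilon> \<longrightarrow>
         diffeomorphism_on lower_triangular_matrices pos_lower_triangular
           symmetric_matrices (TPM \<epsilon>) (Phi_upper C) \<and>
         (\<forall>A\<in>TPM \<epsilon>. \<forall>i j.
            computes A C (algorithm i j) (inv_into pos_lower_triangular (Phi_upper C) A $ i $ j)) \<and>
         (\<lambda>B. Phi_upper C ` B) ` borel_subsets lower_triangular_matrices pos_lower_triangular =
           borel_subsets symmetric_matrices (TPM \<epsilon>) \<and>
         (\<lambda>B. Phi_upper C ` B) ` lebesgue_subsets pos_lower_triangular =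
           lebesgue_subsets (TPM \<epsilon>)"
  proof (intro exI[of _ algorithm] ballI allI impI conjI)
    fix \<epsilon> and C :: "(real, 'n) sqmat"
    assume "\<epsilon> \<in> sign_patterns CARD('n)" and C: "C \<in> TPM \<epsilon>"
    then show Phi: "diffeomorphism_on lower_triangular_matrices pos_lower_triangular
        symmetric_matrices (TPM \<epsilon>) (Phi_upper C)"
      by (rule diffeomorphism_on_Phi_upper)
    show "computes A C (algorithm i j) (inv_into pos_lower_triangular (Phi_upper C) A $ i $ j)"
      if "A \<in> TPM \<epsilon>" for A i j
      using algorithm C that by (simp add: inv_into_Phi_upper[OF C that])
    show "(\<lambda>B. Phi_upper C ` B) ` borel_subsets lower_triangular_matrices pos_lower_triangular =
        borel_subsets symmetric_matrices (TPM \<epsilon>)"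
      by (rule diffeomorphism_on_borel_subsets[OF Phi])
    show "(\<lambda>B. Phi_upper C ` B) ` lebesgue_subsets pos_lower_triangular = lebesgue_subsets (TPM \<epsilon>)"
      by (rule diffeomorphism_on_lebesgue_subsets[OF Phi])
  qed
qed (auto simp: TPM_nonempty disjoint_TPM openin_TPM_all TPM_all_dense exists_TPM_sequence
    reversal_of_real linear_real_reversal real_reversal_Phi_lower real_reversal_TPM_iff
    real_reversal_LPM_iff subspace_symmetric subspace_lower_triangular openin_TPM openin_LPM
    openin_pos_lower_triangular
    intro!: diffeomorphism_on_real_reversal diffeomorphism_on_Phi_lower diffeomorphism_on_Phi_upper
      real_reversal_pos_lower)

end
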